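(* Let $C\subset\mathbb{R}^d$ be a compact set with thickness $\tau:=\tau(C)$, such that $\mathbb{R}^d\setminus E$ contains a ball $B$, where $E$ is the unbounded component of $\mathbb{R}^d\setminus C$ (the union of the two unbounded components when $d=1$). Then $C$ contains a homothetic copy of every set $A\subset\mathbb{R}^d$ with at most $$N(\tau):=\left\lfloor\frac{\beta^d\,|\log(\beta)|}{e\,K_2}\ \frac{\tau^d}{\log(\tau)}\right\rfloor$$ elements, where $$\beta:=\min\Big\{\frac14,\ \frac{15\operatorname{diam}(B)}{16\operatorname{diam}(C)}\Big\}.$$ Moreover, for every such $A$ and all $\lambda\in\Big(0,\frac{\operatorname{diam}(B)}{16\operatorname{diam}(A)}\Big)$, there exists a set $X$ of positive Hausdorff dimension (depending on $A,B,C$ and $\lambda$) such that $$x+\lambda A\subseteq C\quad\text{for all }x\in X.$$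
   Context: Here $d\ge1$, $e$ is Euler's number, $\log$ is the natural logarithm, $\operatorname{dist}$ is Euclidean distance, and $$K_2:=\bigg(\frac{(24\sqrt d)^d(1+4^d\cdot 2)}{1-2^{-d}}\bigg)^2 .$$ A homothetic copy of $A$ is a set $x+\lambda A$ with $x\in\mathbb{R}^d$, $\lambda\ne0$. If $\operatorname{diam}(A)=0$, the upper bound for $\lambda$ is read as $+\infty$. The expression $N(\tau)$ is considered for those $\tau$ for which it is defined. Thickness in $\mathbb{R}^d$. For a compact set $C\subset\mathbb{R}^d$, let $(G_n)_n$ be the (at most countably many, possibly finitely many) bounded open path-connected components of $\mathbb{R}^d\setminus C$, ordered by non-increasing diameter (the order among equal diameters is irrelevant), and let $E$ be the unbounded open path-connected component of $\mathbb{R}^d\setminus C$ (when $d=1$, $E$ is the union of the two unbounded intervals). If $E$ is not the only component of $\mathbb{R}^d\setminus C$, the thickness of $C$ is $$\tau(C):=\inf_n\frac{\operatorname{dist}\big(G_n,\ \bigcup_{1\le i\le n-1}G_i\cup E\big)}{\operatorname{diam}(G_n)},$$ the infimum being over the index set of the $G_n$. If $E$ is the only component, $\tau(C):=+\infty$ when $C$ has non-empty interior and $\tau(C):=0$ when $C$ has empty interior.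
   Formalization: The formal theorem excludes 1 < τ < e^{1/d}, where the statement as written fails: N(τ) tends to infinity as τ decreases to 1, yet a middle Cantor set in the line of thickness slightly above 1 contains no five-term arithmetic progression. *)

theory Defs
  imports "HOL-Analysis.Analysis"
begin

definition bounded_gaps :: "'a::euclidean_space set \<Rightarrow> 'a set set" where
  "bounded_gaps C = {U \<in> path_component_set (- C) ` (- C). bounded U}"

(* A union, because in dimension 1 the complement of a compact set has two unbounded components. *)
definition outer_component :: "'a::euclidean_space set \<Rightarrow> 'a set" where
  "outer_component C = \<Union>{U \<in> path_component_set (- C) ` (- C). \<not> bounded U}"

(* The index set I is an initial segment of the naturals, so finitely many gaps are allowed. *)
definition gap_enumeration ::
    "'a::euclidean_space set \<Rightarrow> nat set \<Rightarrow> (nat \<Rightarrow> 'a set) \<Rightarrow> bool" where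
  "gap_enumeration C I G \<longleftrightarrow>
     (\<forall>n\<in>I. {..<n} \<subseteq> I) \<and>
     bij_betw G I (bounded_gaps C) \<and>
     (\<forall>n\<in>I. \<forall>i<n. diameter (G n) \<le> diameter (G i))"

definition gap_ratio :: "'a::euclidean_space set \<Rightarrow> (nat \<Rightarrow> 'a set) \<Rightarrow> nat \<Rightarrow> real" where
  "gap_ratio C G n = setdist (G n) ((\<Union>i<n. G i) \<union> outer_component C) / diameter (G n)"

(* The gaps cannot always be listed by non-increasing diameter: their diameters may, for
   instance, increase to a positive limit. The thickness then has no meaning, and the value 0
   is a convention. If the gaps can be listed, the choice of the listing does not matter;
   see thickness_eq_Inf below. *)
definition thickness :: "'a::euclidean_space set \<Rightarrow> ereal" where
  "thickness C =
     (if bounded_gaps C = {} then (if interior C = {} then 0 else \<infinity>)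
      else if \<exists>I G. gap_enumeration C I G then
        (let (I, G) = (SOME (I, G). gap_enumeration C I G)
         in INF n\<in>I. ereal (gap_ratio C G n))
      else 0)"

(* Only meant for s > 0. Empty members of a cover contribute 0, so finite covers are included.
   Boundedness is required because diameter is a junk value on unbounded sets. *)
definition hausdorff_premeasure ::
    "real \<Rightarrow> real \<Rightarrow> 'a::metric_space set \<Rightarrow> ennreal" where
  "hausdorff_premeasure s \<delta> X =
     Inf {(\<Sum>i. ennreal (diameter (U i) powr s)) | U :: nat \<Rightarrow> 'a set.
            X \<subseteq> (\<Union>i. U i) \<and> (\<forall>i. bounded (U i) \<and> diameter (U i) \<le> \<delta>)}"

definition hausdorff_outer_measure :: "real \<Rightarrow> 'a::metric_space set \<Rightarrow> ennreal" where
  "hausdorff_outer_measure s X = (SUP \<delta>\<in>{0<..}. hausdorff_premeasure s \<delta> X)"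

definition hausdorff_dim :: "'a::metric_space set \<Rightarrow> ennreal" where
  "hausdorff_dim X = Inf {ennreal s | s. 0 < s \<and> hausdorff_outer_measure s X = 0}"

definition homothetic_copy :: "'a::real_vector set \<Rightarrow> 'a set \<Rightarrow> bool" where
  "homothetic_copy A S \<longleftrightarrow> (\<exists>x l. l \<noteq> 0 \<and> S = (\<lambda>a. x + l *\<^sub>R a) ` A)"

definition K2 :: "nat \<Rightarrow> real" where
  "K2 d = ((24 * sqrt (real d)) ^ d * (1 + 4 ^ d * 2) / (1 - 1 / 2 ^ d))\<^sup>2"

definition scale_ratio :: "'a::metric_space set \<Rightarrow> 'a set \<Rightarrow> real" where
  "scale_ratio B C = min (1 / 4) (15 * diameter B / (16 * diameter C))"

(* Negative for 0 < \<tau> < 1. It tends to infinity as \<tau> decreases to 1, where it is not a valid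
   bound: 1 + \<epsilon> thick Cantor sets in the line contain no five-term arithmetic progression. It is
   meaningful for \<tau> \<ge> exp (1 / d), i.e. when the exponent d - 1 / ln \<tau> is nonnegative. *)
definition max_points :: "nat \<Rightarrow> real \<Rightarrow> real \<Rightarrow> int" where
  "max_points d \<beta> \<tau> = \<lfloor>\<beta> ^ d * \<bar>ln \<beta>\<bar> / (exp 1 * K2 d) * (\<tau> ^ d / ln \<tau>)\<rfloor>"

lemma bounded_gaps_eq_components:
  assumes "compact C"
  shows "bounded_gaps C = {U \<in> components (- C). bounded U}"
  using assms
  by (auto simp: bounded_gaps_def components_def open_path_connected_component_set
      compact_imp_closed open_Compl)

lemma outer_component_eq_outside:
  assumes "compact C"
  shows "outer_component C = outside C"
proof -
  have *: "path_component_set (- C) x = connected_component_set (- C) x" for x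
    using assms by (simp add: open_path_connected_component_set compact_imp_closed open_Compl)
  show ?thesis
  proof
    show "outer_component C \<subseteq> outside C"
    proof
      fix y assume "y \<in> outer_component C"
      then obtain x where x: "x \<in> - C" "\<not> bounded (connected_component_set (- C) x)"
          "y \<in> connected_component_set (- C) x"
        by (auto simp: outer_component_def *)
      then have "y \<in> - C"
        using connected_component_in by fastforce
      moreover have "connected_component_set (- C) y = connected_component_set (- C) x"
        using x(3) by (metis connected_component_eq)
      ultimately show "y \<in> outside C"
        using x by (simp add: outside_def)
    qed
    show "outside C \<subseteq> outer_component C"
    proof
      fix y assume "y \<in> outside C"
      then have y: "y \<in> - C" "\<not> bounded (connected_component_set (- C) y)"
        by (auto simp: outside_def)
      then have "y \<in> connected_component_set (- C) y"
        by (simp add: connected_component_refl)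
      with y show "y \<in> outer_component C"
        unfolding outer_component_def * by blast
    qed
  qed
qed

lemma Inf_gap_ratio_le:
  fixes C :: "'a::euclidean_space set"
  assumes G: "gap_enumeration C I G" and H: "gap_enumeration C J H"
    and E: "outer_component C \<noteq> {}"
  shows "(INF n\<in>I. ereal (gap_ratio C G n)) \<le> (INF n\<in>J. ereal (gap_ratio C H n))"
proof (rule INF_greatest)
  fix n assume n: "n \<in> J"
  have imG: "G ` I = bounded_gaps C" and imH: "H ` J = bounded_gaps C"
    using G H by (auto simp: gap_enumeration_def bij_betw_def)
  obtain m where m: "m \<in> I" "G m = H n"
    using n imG imH by (metis imageE imageI)
  have ne: "U \<noteq> {}" "bounded U" if U: "U \<in> bounded_gaps C" for U
  proof -
    obtain x where "x \<in> - C" "U = path_component_set (- C) x"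
      using U by (auto simp: bounded_gaps_def)
    then have "x \<in> U" by (simp add: path_component_refl)
    then show "U \<noteq> {}" by blast
    show "bounded U" using U by (simp add: bounded_gaps_def)
  qed
  have le: "(INF n\<in>I. ereal (gap_ratio C G n)) \<le> ereal (gap_ratio C G k)" if "k \<in> I" for k
    using that by (rule INF_lower)
  have ge0: "0 \<le> gap_ratio C G k" if "k \<in> I" for k
    unfolding gap_ratio_def using that imG ne
    by (intro divide_nonneg_nonneg setdist_pos_le diameter_ge_0) auto
  have "(INF n\<in>I. ereal (gap_ratio C G n)) \<ge> 0"
    using ge0 by (intro INF_greatest) auto
  then obtain v where v: "(INF n\<in>I. ereal (gap_ratio C G n)) = ereal v" "0 \<le> v"
    using le[OF m(1)] by (cases "(INF n\<in>I. ereal (gap_ratio C G n))") auto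
  have vle: "v \<le> gap_ratio C G k" if "k \<in> I" for k
    using le[OF that] v by simp
  have Hn: "H n \<in> bounded_gaps C"
    using n imH by auto
  show "(INF n\<in>I. ereal (gap_ratio C G n)) \<le> ereal (gap_ratio C H n)"
  proof (cases "diameter (H n) = 0")
    case True
    then have "gap_ratio C G m = gap_ratio C H n"
      by (simp add: gap_ratio_def m)
    then show ?thesis using le[OF m(1)] by simp
  next
    case False
    then have d: "diameter (H n) > 0"
      using diameter_ge_0[OF ne(2)[OF Hn]] by simp
    have key: "v * diameter (G k) \<le> dist x y"
      if "k \<in> I" "diameter (G k) > 0" "x \<in> G k" "y \<in> (\<Union>i<k. G i) \<union> outer_component C" for k x y
    proof -
      have "v * diameter (G k) \<le> setdist (G k) ((\<Union>i<k. G i) \<union> outer_component C)"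
        using vle[OF that(1)] that(2) by (simp add: gap_ratio_def le_divide_eq)
      also have "\<dots> \<le> dist x y"
        using that by (intro setdist_le_dist)
      finally show ?thesis .
    qed
    have "v * diameter (H n) \<le> setdist (H n) ((\<Union>i<n. H i) \<union> outer_component C)"
    proof (rule le_setdistI)
      show "H n \<noteq> {}" "(\<Union>i<n. H i) \<union> outer_component C \<noteq> {}"
        using ne[OF Hn] E by auto
      fix x y assume x: "x \<in> H n" and y: "y \<in> (\<Union>i<n. H i) \<union> outer_component C"
      show "v * diameter (H n) \<le> dist x y"
      proof (cases "y \<in> outer_component C")
        case True
        then show ?thesis using key[of m x y] m d x by simp
      next
        case False
        then obtain i where i: "i < n" "y \<in> H i" using y by auto
        have iJ: "i \<in> J" using H n i by (auto simp: gap_enumeration_def)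
        have dia: "diameter (H n) \<le> diameter (H i)"
          using H n i by (auto simp: gap_enumeration_def)
        obtain k where k: "k \<in> I" "G k = H i"
          using iJ imG imH by (metis imageE imageI)
        have "H i \<noteq> H n"
          using H iJ n i by (auto simp: gap_enumeration_def bij_betw_def dest: inj_onD)
        then consider "k < m" | "m < k" using k m by (metis linorder_neqE_nat)
        then show ?thesis
        proof cases
          case 1
          then show ?thesis using key[of m x y] m d x i k by auto
        next
          case 2
          then have "diameter (G k) \<le> diameter (G m)"
            using G k by (auto simp: gap_enumeration_def)
          then have "diameter (G k) = diameter (H n)"
            using dia m k by simp
          then show ?thesis
            using key[of k y x] 2 m d x i k by (auto simp: dist_commute)
        qed
      qed
    qed
    then have "v \<le> gap_ratio C H n"
      using d by (simp add: gap_ratio_def le_divide_eq)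
    then show ?thesis using v by simp
  qed
qed

lemma thickness_eq_Inf:
  fixes C :: "'a::euclidean_space set"
  assumes "compact C" and "bounded_gaps C \<noteq> {}" and G: "gap_enumeration C I G"
  shows "thickness C = (INF n\<in>I. ereal (gap_ratio C G n))"
proof -
  have E: "outer_component C \<noteq> {}"
    using assms(1) outside_bounded_nonempty[of C]
    by (simp add: outer_component_eq_outside compact_imp_bounded)
  obtain J H where JH: "(SOME (I, G). gap_enumeration C I G) = (J, H)"
    by (cases "(SOME (I, G). gap_enumeration C I G)")
  have "case (J, H) of (I, G) \<Rightarrow> gap_enumeration C I G"
    unfolding JH[symmetric] by (rule someI[of _ "(I, G)"]) (simp add: G)
  then have H: "gap_enumeration C J H" by simp
  have "thickness C = (INF n\<in>J. ereal (gap_ratio C H n))"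
    using assms(2) G by (auto simp: thickness_def JH)
  also have "\<dots> = (INF n\<in>I. ereal (gap_ratio C G n))"
    using Inf_gap_ratio_le[OF G H E] Inf_gap_ratio_le[OF H G E] by (rule antisym[rotated])
  finally show ?thesis .
qed

end

theory Submission
  imports Defs
begin

text \<open>Let $A$ be non-empty, let $n$ be the number of its points, fix an admissible ratio $l > 0$ and a point
  $a_0$ of $A$, and look for $x$ such that no $x + l a$ with $a \in A$ lies in a gap (a bounded
  complementary component) of $C$. If $x$ stays close enough to $z - l a_0$, where $z$ is the centre of
  the ball, then each $x + l a$ lies in the ball, hence not in the outer component, and therefore in
  $C$.

  The search for $x$ runs through a grid: a starting cube is repeatedly divided into $q^d$ cubes, with
  $q = \lceil 1 / \beta \rceil$. Since two gaps are at distance at least $\tau$ times the smaller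
  diameter (\<open>thickness_gap_gap\<close>), a cube $Q + l a$ meets at most one gap whose diameter
  exceeds a constant multiple of the side of $Q$ divided by $\tau$. If the parent of $Q$ did not notice
  this gap already, then it is still much smaller than $Q$, and there is no need to react at once. It is
  dealt with $L$ levels later, at the first level whose cubes are no longer larger than the newly
  noticed gaps may be; all cubes meeting it are then discarded, and there are at most $\kappa$ of them,
  a number bounded in terms of $d$ and $q$. If $N_m$ is the number of cubes of level $m$ that survive,
  this gives \[ N_{m+1} \geq q^d N_m - n \kappa N_{m+1-L} . \] As long as $n \kappa$ is at most about
  $q^{dL} / (e (L + 1))$, induction shows that $N_{m+1} \geq \gamma N_m$ with $\gamma = q^d L / (L + 1)
  > 1$ (\<open>delayed_recursion_growth\<close>). Since $L$ is about $\log \tau / \log q$, this is the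
  bound on $n$ in the theorem (\<open>grid_parameters_exist\<close>). The diameter of $C$ enters through
  $\beta$ only to bound the largest gaps, by \<open>thickness_gap_diameter_le\<close>. By compactness,
  some point lies in a survivor of every level (\<open>exists_point_avoiding\<close>).

  Growth of the number of survivors does not by itself give positive Hausdorff dimension, because they
  may be unevenly distributed. But the recursion has room for discarding, in addition, a small multiple
  of $\gamma^m$ cubes at each level $m$. Given a cover $(V_i)$ of the solution set whose sum of
  $\operatorname{diam}(V_i)^\sigma$ is small, with $\sigma = \log \gamma / \log q$, the cubes that meet
  $V_i$ are discarded at the level where they have about the size of $V_i$
  (\<open>assign_levels\<close>). A solution that is not covered remains, a contradiction; so the
  dimension is at least $\sigma$ (\<open>avoiding_set_hausdorff_dim_pos\<close>).\<close>

section \<open>Subdivision of a cube\<close>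

text \<open>The closed cube of side $t$ at the integer position \<open>k\<close> of the grid with corner \<open>p\<close>. Only the
  values of \<open>k\<close> on \<open>Basis\<close> matter; positions that are to be counted are taken in
  \<open>extensional Basis\<close>, so that distinct cubes have distinct positions.\<close>
definition grid_cube :: "'a::euclidean_space \<Rightarrow> real \<Rightarrow> ('a \<Rightarrow> nat) \<Rightarrow> 'a set" where
  "grid_cube p t k =
     {x. \<forall>b\<in>Basis. t * real (k b) \<le> (x - p) \<bullet> b \<and> (x - p) \<bullet> b \<le> t * (real (k b) + 1)}"

text \<open>The positions, in the grid refined by the factor \<open>q\<close>, of the \<open>q ^ DIM('a)\<close> cubes into which the
  cube at position \<open>j\<close> is divided.\<close>
definition subcubes :: "nat \<Rightarrow> ('a::euclidean_space \<Rightarrow> nat) \<Rightarrow> ('a \<Rightarrow> nat) set" where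
  "subcubes q j = (\<Pi>\<^sub>E b\<in>Basis. {q * j b ..< q * j b + q})"

lemma compact_grid_cube: "compact (grid_cube p t k)"
proof -
  have "grid_cube p t k = cbox (p + (\<Sum>b\<in>Basis. (t * real (k b)) *\<^sub>R b))
      (p + (\<Sum>b\<in>Basis. (t * (real (k b) + 1)) *\<^sub>R b))"
    by (auto simp: grid_cube_def mem_box inner_add_left inner_diff_left le_diff_eq diff_le_eq add.commute)
  then show ?thesis by simp
qed

lemma grid_cube_nonempty:
  assumes "0 \<le> t" shows "grid_cube p t k \<noteq> {}"
proof -
  have "p + (\<Sum>b\<in>Basis. (t * real (k b)) *\<^sub>R b) \<in> grid_cube p t k"
    using assms by (auto simp: grid_cube_def distrib_left)
  then show ?thesis by blast
qed

lemma dist_le_sqrt_DIM: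
  fixes x y :: "'a::euclidean_space"
  assumes "\<And>b. b \<in> Basis \<Longrightarrow> \<bar>(x - y) \<bullet> b\<bar> \<le> t" and "0 \<le> t"
  shows "dist x y \<le> sqrt (real DIM('a)) * t"
proof -
  have "(dist x y)\<^sup>2 = (\<Sum>b\<in>Basis. ((x - y) \<bullet> b)\<^sup>2)"
    unfolding dist_norm power2_norm_eq_inner
    by (subst euclidean_inner) (simp add: power2_eq_square)
  also have "\<dots> \<le> (\<Sum>b\<in>(Basis::'a set). t\<^sup>2)"
    using assms by (intro sum_mono) (metis abs_le_square_iff abs_of_nonneg)
  also have "\<dots> = (sqrt (real DIM('a)) * t)\<^sup>2"
    by (simp add: power_mult_distrib)
  finally show ?thesis
    by (rule power2_le_imp_le) (use assms in simp)
qed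

lemma dist_grid_cube_le:
  fixes p :: "'a::euclidean_space"
  assumes "x \<in> grid_cube p t k" "y \<in> grid_cube p t k" "0 \<le> t"
  shows "dist x y \<le> sqrt (real DIM('a)) * t"
proof (rule dist_le_sqrt_DIM[OF _ assms(3)])
  fix b :: 'a assume "b \<in> Basis"
  with assms have "t * real (k b) \<le> (x - p) \<bullet> b" "(x - p) \<bullet> b \<le> t * (real (k b) + 1)"
    "t * real (k b) \<le> (y - p) \<bullet> b" "(y - p) \<bullet> b \<le> t * (real (k b) + 1)"
    by (auto simp: grid_cube_def)
  then show "\<bar>(x - y) \<bullet> b\<bar> \<le> t" by (simp add: inner_simps algebra_simps)
qed

lemma grid_cube_subset_parent:
  assumes "k \<in> subcubes q j" "0 < t" "0 < q"
  shows "grid_cube p (t / real q) k \<subseteq> grid_cube p t j"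
proof
  fix x assume x: "x \<in> grid_cube p (t / real q) k"
  show "x \<in> grid_cube p t j"
    unfolding grid_cube_def
  proof safe
    fix b :: 'a assume b: "b \<in> Basis"
    have k: "q * j b \<le> k b" "k b + 1 \<le> q * (j b + 1)"
      using assms(1) b by (auto simp: subcubes_def PiE_iff Suc_le_eq)
    have "real q * real (j b) \<le> real (k b)" "real (k b) + 1 \<le> real q * (real (j b) + 1)"
      using k[THEN of_nat_mono[where 'a=real]] by (simp_all add: algebra_simps)
    then have *: "t / q * (real q * real (j b)) \<le> t / q * real (k b)"
        "t / q * (real (k b) + 1) \<le> t / q * (real q * (real (j b) + 1))"
      using assms by (intro mult_left_mono; simp)+
    have x': "t / q * real (k b) \<le> (x - p) \<bullet> b" "(x - p) \<bullet> b \<le> t / q * (real (k b) + 1)"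
      using x b by (auto simp: grid_cube_def)
    show "t * real (j b) \<le> (x - p) \<bullet> b" using *(1) x'(1) assms by simp
    show "(x - p) \<bullet> b \<le> t * (real (j b) + 1)" using *(2) x'(2) assms by simp
  qed
qed

lemma finite_subcubes: "finite (subcubes q j)"
  by (simp add: subcubes_def finite_PiE)

lemma card_subcubes: "card (subcubes q (j :: 'a::euclidean_space \<Rightarrow> nat)) = q ^ DIM('a)"
  by (simp add: subcubes_def card_PiE)

lemma card_Union_subcubes:
  fixes T :: "('a::euclidean_space \<Rightarrow> nat) set"
  assumes "finite T" "T \<subseteq> extensional Basis" "0 < q"
  shows "card (\<Union>j\<in>T. subcubes q j) = q ^ DIM('a) * card T"
proof -
  have "i = j" if "i \<in> T" "j \<in> T" "k \<in> subcubes q i" "k \<in> subcubes q j" for i j k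
  proof (rule extensionalityI[of _ Basis])
    show "i \<in> extensional Basis" "j \<in> extensional Basis" using that assms by auto
    fix b :: 'a assume "b \<in> Basis"
    then have "q * i b \<le> k b" "k b < q * i b + q" "q * j b \<le> k b" "k b < q * j b + q"
      using that by (auto simp: subcubes_def PiE_iff)
    then have "k b div q = i b" "k b div q = j b"
      by (auto intro!: div_nat_eqI simp: algebra_simps)
    then show "i b = j b" by simp
  qed
  then have "card (\<Union>j\<in>T. subcubes q j) = (\<Sum>j\<in>T. card (subcubes q j))"
    by (intro card_UN_disjoint) (auto simp: assms finite_subcubes)
  then show ?thesis by (simp add: card_subcubes)
qed

text \<open>Two cubes that meet the same set of diameter at most \<open>W * t\<close> have positions that differ by at most
  \<open>W + 1\<close> in each coordinate.\<close>
lemma card_cubes_meeting: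
  fixes p :: "'a::euclidean_space"
  assumes V: "bounded V" "diameter V \<le> real W * t" and t: "0 < t"
  shows "finite {k \<in> extensional Basis. V \<inter> grid_cube p t k \<noteq> {}}" (is "finite ?K")
    and "card {k \<in> extensional Basis. V \<inter> grid_cube p t k \<noteq> {}} \<le> (2 * W + 3) ^ DIM('a)"
proof -
  have "finite ?K \<and> card ?K \<le> (2 * W + 3) ^ DIM('a)"
  proof (cases "?K = {}")
    case False
    then obtain k0 where k0: "k0 \<in> ?K" by blast
    let ?P = "\<Pi>\<^sub>E b\<in>Basis. {k0 b - (W + 1) .. k0 b + (W + 1)}"
    have "?K \<subseteq> ?P"
    proof
      fix k assume k: "k \<in> ?K"
      from k k0 obtain x y where x: "x \<in> V" "x \<in> grid_cube p t k"
        and y: "y \<in> V" "y \<in> grid_cube p t k0" by blast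
      show "k \<in> ?P"
      proof (rule PiE_I)
        show "k b = undefined" if "b \<notin> Basis" for b
          using k that by (auto simp: extensional_def)
        fix b :: 'a assume b: "b \<in> Basis"
        have "\<bar>(x - y) \<bullet> b\<bar> \<le> norm (x - y)" using b by (simp add: Basis_le_norm)
        also have "\<dots> \<le> real W * t"
          using diameter_bounded_bound[OF V(1) x(1) y(1)] V(2) by (simp add: dist_norm)
        finally have *: "\<bar>(x - p) \<bullet> b - (y - p) \<bullet> b\<bar> \<le> real W * t"
          by (simp add: inner_simps)
        have "t * real (k b) \<le> (x - p) \<bullet> b" "(x - p) \<bullet> b \<le> t * (real (k b) + 1)"
          "t * real (k0 b) \<le> (y - p) \<bullet> b" "(y - p) \<bullet> b \<le> t * (real (k0 b) + 1)"
          using x y b by (auto simp: grid_cube_def)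
        with * have "t * real (k b) \<le> t * real (k0 b + (W + 1))"
            "t * real (k0 b) \<le> t * real (k b + (W + 1))"
          by (simp_all add: algebra_simps)
        then have "real (k b) \<le> real (k0 b + (W + 1))" "real (k0 b) \<le> real (k b + (W + 1))"
          using t by (simp_all only: mult_le_cancel_left_pos)
        then show "k b \<in> {k0 b - (W + 1) .. k0 b + (W + 1)}" by auto
      qed
    qed
    moreover have "finite ?P" by (simp add: finite_PiE)
    moreover have "card ?P \<le> (2 * W + 3) ^ DIM('a)"
    proof -
      have "card ?P = (\<Prod>b\<in>(Basis::'a set). card {k0 b - (W + 1) .. k0 b + (W + 1)})"
        by (simp add: card_PiE)
      also have "\<dots> \<le> (\<Prod>b\<in>(Basis::'a set). 2 * W + 3)"
        by (intro prod_mono) auto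
      finally show ?thesis by simp
    qed
    ultimately show ?thesis by (meson card_mono finite_subset le_trans)
  next
    case True
    show ?thesis unfolding True by simp
  qed
  then show "finite ?K" "card ?K \<le> (2 * W + 3) ^ DIM('a)" by auto
qed

section \<open>Surviving cubes and their growth\<close>

text \<open>The tree of surviving cubes, by levels: a cube of level \<open>m + 1\<close> survives if its parent does and
  \<open>kill (m + 1)\<close> does not hold of it. The single cube of level 0 always survives.\<close>
primrec survivors ::
    "nat \<Rightarrow> (nat \<Rightarrow> ('a::euclidean_space \<Rightarrow> nat) \<Rightarrow> bool) \<Rightarrow> nat \<Rightarrow> ('a \<Rightarrow> nat) set" where
  "survivors q kill 0 = {\<lambda>b\<in>Basis. 0}"
| "survivors q kill (Suc m) =
     {k \<in> (\<Union>j\<in>survivors q kill m. subcubes q j). \<not> kill (Suc m) k}"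

lemma survivors_extensional: "survivors q kill m \<subseteq> extensional Basis"
  by (cases m) (auto simp: subcubes_def PiE_def)

lemma finite_survivors: "finite (survivors q kill m)"
  by (induction m) (auto simp: finite_subcubes)

lemma survivors_ancestor:
  assumes "k \<in> survivors q kill (m + i)" "0 < s" "0 < q"
  shows "\<exists>R\<in>survivors q kill m. grid_cube p (s / q ^ (m + i)) k \<subseteq> grid_cube p (s / q ^ m) R"
  using assms(1)
proof (induction i arbitrary: k)
  case (Suc i)
  then obtain j where j: "j \<in> survivors q kill (m + i)" "k \<in> subcubes q j" by auto
  have "grid_cube p (s / q ^ (m + i) / q) k \<subseteq> grid_cube p (s / q ^ (m + i)) j"
    using j assms by (intro grid_cube_subset_parent) auto
  then show ?case using Suc.IH[OF j(1)] by (auto simp: field_simps)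
qed auto

lemma card_survivors_Suc:
  fixes kill :: "nat \<Rightarrow> ('a::euclidean_space \<Rightarrow> nat) \<Rightarrow> bool"
  assumes "0 < q"
  shows "q ^ DIM('a) * card (survivors q kill m) \<le> card (survivors q kill (Suc m))
    + card {k \<in> (\<Union>j\<in>survivors q kill m. subcubes q j). kill (Suc m) k}"
proof -
  let ?U = "\<Union>j\<in>survivors q kill m. subcubes q j"
  have "card ?U = q ^ DIM('a) * card (survivors q kill m)"
    using assms by (intro card_Union_subcubes finite_survivors survivors_extensional)
  moreover have "?U = survivors q kill (Suc m) \<union> {k \<in> ?U. kill (Suc m) k}" by auto
  then have "card ?U \<le> card (survivors q kill (Suc m)) + card {k \<in> ?U. kill (Suc m) k}"
    by (metis card_Un_le)
  ultimately show ?thesis by simp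
qed

text \<open>The counting argument in numerical form. Of the $Q N_m$ children of the survivors of level $m$, at most
  $M N_{m+1-L}$ are lost to obstacles that were first noticed $L$ levels above, and at most $e_{m+1}$ to
  other causes. The delay is what makes the loss affordable: by induction
  $N_{m+1-L} \leq N_m / \gamma^{L-1}$, so that each of the two losses is at most half of
  $\epsilon Q N_m$.\<close>
lemma delayed_recursion_growth:
  fixes N e :: "nat \<Rightarrow> real"
  assumes N0: "N 0 = 1" and pos: "\<And>m. 0 \<le> N m"
    and rec: "\<And>m. N (Suc m) \<ge> Q * N m - (if L \<le> Suc m then M * N (Suc m - L) else 0) - e (Suc m)"
    and \<epsilon>: "0 < \<epsilon>" "\<epsilon> < 1" and Q: "0 < Q" and \<gamma>: "\<gamma> = (1 - \<epsilon>) * Q" and L: "1 \<le> L"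
    and M: "0 \<le> M" "2 * M \<le> \<epsilon> * Q * \<gamma> ^ (L - 1)"
    and e: "\<And>m. 2 * e m \<le> \<epsilon> * \<gamma> ^ m"
  shows "\<gamma> * N m \<le> N (Suc m) \<and> \<gamma> ^ m \<le> N m"
proof (induction m rule: less_induct)
  case (less m)
  have \<gamma>0: "0 < \<gamma>" "\<gamma> \<le> Q" 
    unfolding \<gamma> using \<epsilon> Q by (simp_all add: mult_left_le_one_le)
  have low: "\<gamma> ^ m \<le> N m"
  proof (cases m)
    case (Suc k)
    have "\<gamma> ^ m \<le> \<gamma> * N k" using less[of k] Suc \<gamma>0 by simp
    also have "\<dots> \<le> N m" using less[of k] Suc by simp
    finally show ?thesis .
  qed (use N0 in simp)
  have lag: "\<gamma> ^ i * N (m - i) \<le> N m" if "i \<le> m" for i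
    using that
  proof (induction i)
    case (Suc i)
    have "\<gamma> ^ Suc i * N (m - Suc i) = \<gamma> ^ i * (\<gamma> * N (m - Suc i))" by simp
    also have "\<dots> \<le> \<gamma> ^ i * N (m - i)"
      using less[of "m - Suc i"] Suc.prems \<gamma>0
      by (intro mult_left_mono) (auto simp: Suc_diff_Suc)
    also have "\<dots> \<le> N m" using Suc by simp
    finally show ?case .
  qed simp
  have 1: "2 * (if L \<le> Suc m then M * N (Suc m - L) else 0) \<le> \<epsilon> * Q * N m"
  proof (cases "L \<le> Suc m")
    case True
    have "2 * (M * N (Suc m - L)) \<le> \<epsilon> * Q * \<gamma> ^ (L - 1) * N (Suc m - L)"
      using mult_right_mono[OF M(2) pos[of "Suc m - L"]] by simp
    also have "\<dots> = \<epsilon> * Q * (\<gamma> ^ (L - 1) * N (m - (L - 1)))" using L by simp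
    also have "\<dots> \<le> \<epsilon> * Q * N m"
      using lag[of "L - 1"] True \<epsilon> Q by (intro mult_left_mono) auto
    finally show ?thesis using True by simp
  qed (use \<epsilon> Q pos in simp)
  have 2: "2 * e (Suc m) \<le> \<epsilon> * Q * N m"
  proof -
    have "2 * e (Suc m) \<le> \<epsilon> * \<gamma> * \<gamma> ^ m" using e[of "Suc m"] by simp
    also have "\<dots> \<le> \<epsilon> * Q * N m"
      using low \<gamma>0 \<epsilon> Q by (intro mult_mono) auto
    finally show ?thesis .
  qed
  have "\<gamma> * N m = Q * N m - \<epsilon> * Q * N m" by (simp add: \<gamma> algebra_simps)
  then show ?case using 1 2 rec[of m] low by linarith
qed

section \<open>Points avoiding sparse obstacles\<close>

text \<open>The core of the proof. For each \<open>a \<in> I\<close> the obstacles \<open>F a\<close> are so sparse that a cube of level \<open>m\<close>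
  meets at most one of them of diameter greater than \<open>\<theta> / q ^ m\<close>. A cube of level \<open>m\<close> is discarded if it
  meets an obstacle of diameter greater than \<open>\<theta> / q ^ (m - L)\<close>, or one of the further sets \<open>V i\<close> with
  \<open>lev i = m\<close>. An obstacle that discards a cube of level \<open>m + 1\<close> has not discarded the parent, so it
  is, for some \<open>a\<close>, the only large one meeting the ancestor of level \<open>m + 1 - L\<close>; and it meets at most
  \<open>(2 * W + 3) ^ DIM('a)\<close> cubes of level \<open>m + 1\<close>. This is the recursion of \<open>delayed_recursion_growth\<close>.\<close>
lemma exists_point_avoiding:
  fixes p :: "'a::euclidean_space" and F :: "'i \<Rightarrow> 'a set set" and V :: "nat \<Rightarrow> 'a set"
  assumes I: "finite I" and s: "0 < s" and q: "1 < q" and L: "1 \<le> L" and \<theta>: "0 < \<theta>"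
    and bdd: "\<And>a U. a \<in> I \<Longrightarrow> U \<in> F a \<Longrightarrow> bounded U"
    and big: "\<And>a U. a \<in> I \<Longrightarrow> U \<in> F a \<Longrightarrow> diameter U \<le> \<theta> * real q"
    and sep: "\<And>a m R U U'. \<lbrakk>a \<in> I; U \<in> F a; U' \<in> F a;
        U \<inter> grid_cube p (s / real q ^ m) R \<noteq> {}; U' \<inter> grid_cube p (s / real q ^ m) R \<noteq> {};
        \<theta> / real q ^ m < diameter U; \<theta> / real q ^ m < diameter U'\<rbrakk> \<Longrightarrow> U = U'"
    and W: "\<theta> * real q ^ (L + 1) \<le> real W * s"
    and \<epsilon>: "0 < \<epsilon>" "\<epsilon> < 1" and \<gamma>: "\<gamma> = (1 - \<epsilon>) * real q ^ DIM('a)"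
    and few: "2 * (real (card I) * real (2 * W + 3) ^ DIM('a)) \<le> \<epsilon> * real q ^ DIM('a) * \<gamma> ^ (L - 1)"
    and V: "\<And>i. bounded (V i)" "\<And>i. diameter (V i) \<le> s / real q ^ lev i"
    and lev: "\<And>m. finite {i. lev i = m}"
      "\<And>m. 2 * 5 ^ DIM('a) * real (card {i. lev i = m}) \<le> \<epsilon> * \<gamma> ^ m"
  shows "\<exists>x\<in>grid_cube p s (\<lambda>b\<in>Basis. 0).
    (\<forall>i. x \<notin> V i) \<and> (\<forall>a\<in>I. \<forall>U\<in>F a. 0 < diameter U \<longrightarrow> x \<notin> U)"
proof -
  let ?cube = "\<lambda>m. grid_cube p (s / real q ^ m)"
  define killF where "killF = (\<lambda>m k. L \<le> m \<and>
    (\<exists>a\<in>I. \<exists>U\<in>F a. U \<inter> ?cube m k \<noteq> {} \<and> \<theta> / real q ^ (m - L) < diameter U))"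
  define killV where "killV = (\<lambda>m k. \<exists>i. lev i = m \<and> V i \<inter> ?cube m k \<noteq> {})"
  define S where "S = survivors q (\<lambda>m k. killF m k \<or> killV m k)"
  define N where "N = (\<lambda>m. real (card (S m)))"
  define M where "M = real (card I) * real (2 * W + 3) ^ DIM('a)"
  define e where "e = (\<lambda>m. 5 ^ DIM('a) * real (card {i. lev i = m}))"
  have finS: "finite (S m)" and extS: "S m \<subseteq> extensional Basis" for m
    by (simp_all add: S_def finite_survivors survivors_extensional)
  have anc: "\<exists>R\<in>S m. ?cube (m + i) k \<subseteq> ?cube m R" if "k \<in> S (m + i)" for m i k
    using survivors_ancestor[of k q _ m i s p] that s q unfolding S_def by auto
  have sub: "?cube (Suc m) k \<subseteq> ?cube m j" if "k \<in> subcubes q j" for m k j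
    using grid_cube_subset_parent[OF that, of "s / q ^ m" p] s q by (simp add: field_simps)
  have SSuc: "S (Suc m) = {k \<in> (\<Union>j\<in>S m. subcubes q j). \<not> (killF (Suc m) k \<or> killV (Suc m) k)}" for m
    by (simp add: S_def)
  have rec: "N (Suc m) \<ge> real q ^ DIM('a) * N m - (if L \<le> Suc m then M * N (Suc m - L) else 0) - e (Suc m)" for m
  proof -
    let ?U = "\<Union>j\<in>S m. subcubes q j"
    let ?A = "{k \<in> ?U. killF (Suc m) k}" and ?B = "{k \<in> ?U. killV (Suc m) k}"
    have extU: "?U \<subseteq> extensional Basis" by (auto simp: subcubes_def PiE_def)
    have B: "real (card ?B) \<le> e (Suc m)"
    proof -
      let ?J = "{i. lev i = Suc m}"
      let ?K = "\<lambda>i. {k \<in> extensional Basis. V i \<inter> ?cube (Suc m) k \<noteq> {}}"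
      have K: "finite (?K i)" "card (?K i) \<le> 5 ^ DIM('a)" if "i \<in> ?J" for i
        using card_cubes_meeting[OF V(1)[of i], of 1 "s / real q ^ Suc m" p] V(2)[of i] that s q by auto
      have "card ?B \<le> card (\<Union>i\<in>?J. ?K i)"
      proof (rule card_mono)
        show "finite (\<Union>i\<in>?J. ?K i)" using K(1) lev(1) by blast
        show "?B \<subseteq> (\<Union>i\<in>?J. ?K i)" using extU unfolding killV_def by blast
      qed
      also have "\<dots> \<le> (\<Sum>i\<in>?J. card (?K i))"
        by (intro card_UN_le lev)
      also have "\<dots> \<le> (\<Sum>i\<in>?J. 5 ^ DIM('a))"
        by (intro sum_mono K)
      finally have "card ?B \<le> 5 ^ DIM('a) * card ?J" by (simp add: mult.commute)
      then have "real (card ?B) \<le> real (5 ^ DIM('a) * card ?J)" by (rule of_nat_mono)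
      then show ?thesis by (simp add: e_def)
    qed
    have A: "real (card ?A) \<le> (if L \<le> Suc m then M * N (Suc m - L) else 0)"
    proof (cases "L \<le> Suc m")
      case False
      then show ?thesis by (simp add: killF_def)
    next
      case True
      define j where "j = Suc m - L"
      have mj: "Suc m = j + L" using True by (simp add: j_def)
      \<comment> \<open>The obstacle for \<open>a\<close> that is noticed in the ancestor at position \<open>R\<close> of level \<open>j\<close>.\<close>
      let ?P = "\<lambda>R a U. U \<in> F a \<and> U \<inter> ?cube j R \<noteq> {} \<and> \<theta> / real q ^ j < diameter U
        \<and> diameter U \<le> \<theta> * real q / real q ^ j"
      let ?K = "\<lambda>R a. {k \<in> extensional Basis. \<exists>U. ?P R a U \<and> U \<inter> ?cube (Suc m) k \<noteq> {}}"
      have K: "finite (?K R a) \<and> card (?K R a) \<le> (2 * W + 3) ^ DIM('a)" if a: "a \<in> I" for R a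
      proof (cases "\<exists>U. ?P R a U")
        case True
        then obtain U where U: "?P R a U" by blast
        have un: "U' = U" if "?P R a U'" for U'
          using sep[OF a, of U' U j R] U that by auto
        have "?K R a \<subseteq> {k \<in> extensional Basis. U \<inter> ?cube (Suc m) k \<noteq> {}}"
          using un by blast
        moreover have "diameter U \<le> real W * (s / real q ^ Suc m)"
        proof -
          have "\<theta> * real q / real q ^ j = \<theta> * real q ^ (L + 1) / real q ^ Suc m"
            unfolding mj using q by (simp add: power_add field_simps)
          also have "\<dots> \<le> real W * s / real q ^ Suc m"
            using W by (intro divide_right_mono) auto
          finally show ?thesis using U by simp
        qed
        then have "finite {k \<in> extensional Basis. U \<inter> ?cube (Suc m) k \<noteq> {}}"
          "card {k \<in> extensional Basis. U \<inter> ?cube (Suc m) k \<noteq> {}} \<le> (2 * W + 3) ^ DIM('a)"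
          using card_cubes_meeting[of U W "s / real q ^ Suc m" p] bdd[OF a, of U] U s q by auto
        ultimately show ?thesis by (meson card_mono finite_subset le_trans)
      next
        case False
        then have empty: "?K R a = {}" by blast
        show ?thesis unfolding empty by simp
      qed
      have "?A \<subseteq> (\<Union>R\<in>S j. \<Union>a\<in>I. ?K R a)"
      proof
        fix k assume k: "k \<in> ?A"
        then obtain i where i: "i \<in> S m" "k \<in> subcubes q i" by blast
        from k obtain a U where aU: "a \<in> I" "U \<in> F a" "U \<inter> ?cube (Suc m) k \<noteq> {}"
          "\<theta> / real q ^ j < diameter U" by (auto simp: killF_def j_def)
        obtain R where R: "R \<in> S j" "?cube m i \<subseteq> ?cube j R"
          using anc[of i j "m - j"] i mj L by auto
        have Ui: "U \<inter> ?cube m i \<noteq> {}" using aU(3) sub[OF i(2), of m] by blast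
        \<comment> \<open>At level \<open>L\<close> there is no earlier level at which larger obstacles were discarded; there the
            bound \<open>big\<close> on all obstacles takes over.\<close>
        have "diameter U \<le> \<theta> * real q / real q ^ j"
        proof (cases j)
          case 0
          then show ?thesis using big[OF aU(1,2)] by simp
        next
          case (Suc j')
          then have m: "m = j' + L" using mj by simp
          then obtain m' where m': "m = Suc m'" using L not0_implies_Suc[of m] by auto
          then have "\<not> killF m i" using i(1) SSuc by auto
          then have "diameter U \<le> \<theta> / real q ^ j'"
            using aU Ui m unfolding killF_def by fastforce
          then show ?thesis using Suc q by simp
        qed
        then have "k \<in> ?K R a" using k extU aU Ui R(2) by blast
        then show "k \<in> (\<Union>R\<in>S j. \<Union>a\<in>I. ?K R a)" using R aU by blast
      qed
      then have "card ?A \<le> card (\<Union>R\<in>S j. \<Union>a\<in>I. ?K R a)"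
        using K finS I by (intro card_mono) auto
      also have "\<dots> \<le> (\<Sum>R\<in>S j. \<Sum>a\<in>I. card (?K R a))"
        by (intro order_trans[OF card_UN_le] sum_mono card_UN_le finS I)
      also have "\<dots> \<le> (\<Sum>R\<in>S j. \<Sum>a\<in>I. (2 * W + 3) ^ DIM('a))"
        using K by (intro sum_mono) auto
      finally have "card ?A \<le> card (S j) * (card I * (2 * W + 3) ^ DIM('a))" by simp
      then have "real (card ?A) \<le> real (card (S j) * (card I * (2 * W + 3) ^ DIM('a)))"
        by (rule of_nat_mono)
      then show ?thesis using True by (simp add: M_def N_def j_def mult.commute)
    qed
    have "q ^ DIM('a) * card (S m) \<le> card (S (Suc m)) + card (?A \<union> ?B)"
      using card_survivors_Suc[of q "\<lambda>m k. killF m k \<or> killV m k" m] q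
      by (simp add: S_def Collect_disj_eq conj_disj_distribL)
    also have "card (?A \<union> ?B) \<le> card ?A + card ?B" by (rule card_Un_le)
    finally have "real (q ^ DIM('a) * card (S m)) \<le> real (card (S (Suc m)) + (card ?A + card ?B))"
      by (intro of_nat_mono) simp
    then show ?thesis using A B by (simp add: N_def)
  qed
  have "\<gamma> ^ m \<le> N m" for m
  proof -
    have "\<gamma> * N m \<le> N (Suc m) \<and> \<gamma> ^ m \<le> N m"
    proof (rule delayed_recursion_growth[OF _ _ rec \<epsilon> _ \<gamma> L])
      show "N 0 = 1" by (simp add: N_def S_def)
      show "2 * M \<le> \<epsilon> * real q ^ DIM('a) * \<gamma> ^ (L - 1)" using few by (simp add: M_def)
      show "2 * e m \<le> \<epsilon> * \<gamma> ^ m" for m using lev(2)[of m] by (simp add: e_def)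
    qed (use q in \<open>auto simp: N_def M_def\<close>)
    then show ?thesis by simp
  qed
  moreover have "0 < \<gamma> ^ m" for m using \<gamma> \<epsilon> q by simp
  ultimately have Npos: "0 < N m" for m by (meson less_le_trans)
  then have Sne: "S m \<noteq> {}" for m by (metis N_def card.empty less_irrefl of_nat_0)
  define K where "K = (\<lambda>m. \<Union>k\<in>S m. ?cube m k)"
  have "\<Inter>(range K) \<noteq> {}"
  proof (rule compact_nest)
    show "compact (K m)" for m
      unfolding K_def by (intro compact_UN finS compact_grid_cube)
    show "K m \<noteq> {}" for m
      using Sne[of m] grid_cube_nonempty[of "s / real q ^ m" p] s q unfolding K_def by fastforce
    show "K n \<subseteq> K m" if "m \<le> n" for m n
      using anc[of _ m "n - m"] that unfolding K_def by fastforce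
  qed
  then obtain x where x: "x \<in> K m" for m by blast
  show ?thesis
  proof (intro bexI conjI allI ballI impI)
    show "x \<in> grid_cube p s (\<lambda>b\<in>Basis. 0)"
      using x[of 0] by (simp add: K_def S_def)
    show "x \<notin> V i" for i
    proof
      assume xi: "x \<in> V i"
      \<comment> \<open>The cube of level 0 is never discarded, so no \<open>V i\<close> may have level 0; indeed the bound on
          their number is less than 1 there.\<close>
      have "lev i \<noteq> 0"
      proof
        assume "lev i = 0"
        then have "card {i. lev i = 0} \<noteq> 0" using lev(1)[of 0] by auto
        then have "1 \<le> real (card {i. lev i = 0})" by simp
        moreover have "(1::real) \<le> 5 ^ DIM('a)" by simp
        ultimately have "1 * 1 \<le> 5 ^ DIM('a) * real (card {i. lev i = 0})" by (intro mult_mono) auto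
        then show False using lev(2)[of 0] \<epsilon> by simp
      qed
      then obtain m where m: "lev i = Suc m" by (cases "lev i") auto
      obtain k where "k \<in> S (Suc m)" "x \<in> ?cube (Suc m) k" using x[of "Suc m"] unfolding K_def by blast
      then show False using xi m by (auto simp: SSuc killV_def)
    qed
    show "x \<notin> U" if a: "a \<in> I" "U \<in> F a" "0 < diameter U" for a U
    proof
      assume xU: "x \<in> U"
      obtain j where j: "(1 / real q) ^ j < diameter U / \<theta>"
        using real_arch_pow_inv[of "diameter U / \<theta>" "1 / real q"] a \<theta> q by auto
      then have j': "\<theta> / real q ^ j < diameter U" using \<theta> q by (simp add: field_simps)
      obtain m where m: "j + L = Suc m" using L not0_implies_Suc[of "j + L"] by auto
      obtain k where "k \<in> S (Suc m)" "x \<in> ?cube (Suc m) k" using x[of "Suc m"] unfolding K_def by blast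
      moreover then have "killF (Suc m) k"
        unfolding killF_def m[symmetric] using xU a j' by auto
      ultimately show False by (simp add: SSuc)
    qed
  qed
qed

section \<open>Hausdorff dimension of the avoiding set\<close>

text \<open>The dimension is at least \<open>\<sigma>\<close> once no cover of \<open>X\<close> has a \<open>\<sigma>\<close>-dimensional cost below a fixed
  bound: for an exponent smaller than \<open>\<sigma>\<close>, sets of diameter at most 1 cost at least as much.\<close>
lemma hausdorff_dim_posI:
  fixes X :: "'a::metric_space set"
  assumes \<sigma>: "0 < \<sigma>" and \<eta>: "0 < \<eta>"
    and esc: "\<And>U :: nat \<Rightarrow> 'a set. \<lbrakk>\<And>i. bounded (U i); 
      \<And>J. finite J \<Longrightarrow> (\<Sum>i\<in>J. diameter (U i) powr \<sigma>) \<le> \<eta>\<rbrakk> \<Longrightarrow> \<not> X \<subseteq> (\<Union>i. U i)"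
  shows "0 < hausdorff_dim X"
proof -
  have "ennreal \<sigma> \<le> hausdorff_dim X"
    unfolding hausdorff_dim_def
  proof (rule Inf_greatest, safe)
    fix t :: real assume t: "0 < t" "hausdorff_outer_measure t X = 0"
    show "ennreal \<sigma> \<le> ennreal t"
    proof (rule ccontr)
      assume "\<not> ennreal \<sigma> \<le> ennreal t"
      then have "t < \<sigma>" using t by (simp add: ennreal_le_iff)
      have "hausdorff_premeasure t 1 X \<le> hausdorff_outer_measure t X"
        unfolding hausdorff_outer_measure_def by (rule SUP_upper) simp
      then have "hausdorff_premeasure t 1 X < ennreal \<eta>" using t \<eta> by simp
      then obtain U :: "nat \<Rightarrow> 'a set" where U: "X \<subseteq> (\<Union>i. U i)"
          "\<And>i. bounded (U i)" "\<And>i. diameter (U i) \<le> 1"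
          "(\<Sum>i. ennreal (diameter (U i) powr t)) < ennreal \<eta>"
        unfolding hausdorff_premeasure_def Inf_less_iff by blast
      have "(\<Sum>i\<in>J. diameter (U i) powr \<sigma>) \<le> \<eta>" if J: "finite J" for J
      proof -
        have "(\<Sum>i\<in>J. diameter (U i) powr \<sigma>) \<le> (\<Sum>i\<in>J. diameter (U i) powr t)"
          using U(2,3) \<open>t < \<sigma>\<close> diameter_ge_0[OF U(2)] by (intro sum_mono powr_mono') auto
        also have "\<dots> \<le> \<eta>"
        proof -
          have "ennreal (\<Sum>i\<in>J. diameter (U i) powr t) = (\<Sum>i\<in>J. ennreal (diameter (U i) powr t))"
            by simp
          also have "\<dots> \<le> (\<Sum>i. ennreal (diameter (U i) powr t))"
            by (intro sum_le_suminf J) auto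
          also have "\<dots> < ennreal \<eta>" by (rule U)
          finally show ?thesis by (simp add: ennreal_less_iff sum_nonneg)
        qed
        finally show ?thesis .
      qed
      then show False using esc[of U] U by blast
    qed
  qed
  then show ?thesis using \<sigma> by (metis ennreal_less_zero_iff less_le_trans)
qed

text \<open>The members of a cheap cover are distributed over the levels of the grid, with side length
  $s / q^m$ at level $m$, so that each fits the cubes of its level and level $m$ receives at most a
  constant times $\gamma^m$ of them. The exponent \<open>ln \<gamma> / ln q\<close> is the one for which $q^m$ turns into $\gamma^m$.\<close>
lemma assign_levels:
  fixes U :: "nat \<Rightarrow> 'a::metric_space set"
  assumes s: "0 < s" and q: "1 < q" and \<gamma>: "1 < \<gamma>" and \<eta>: "0 < \<eta>" "2 * \<eta> \<le> s powr (ln \<gamma> / ln q)"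
    and sum: "\<And>J. finite J \<Longrightarrow> (\<Sum>i\<in>J. diameter (U i) powr (ln \<gamma> / ln q)) \<le> \<eta>"
    and bdd: "\<And>i. bounded (U i)"
  obtains lev :: "nat \<Rightarrow> nat" where "\<And>i. diameter (U i) \<le> s / q ^ lev i"
    and "\<And>m. finite {i. lev i = m}"
    and "\<And>m. real (card {i. lev i = m}) * s powr (ln \<gamma> / ln q) \<le> 2 * \<eta> * \<gamma> ^ (m + 1)"
proof -
  define \<sigma> where "\<sigma> = ln \<gamma> / ln q"
  have \<sigma>: "0 < \<sigma>" using q \<gamma> by (simp add: \<sigma>_def)
  have q\<sigma>: "(q ^ m) powr \<sigma> = \<gamma> ^ m" for m
  proof -
    have "(q ^ m) powr \<sigma> = (q powr \<sigma>) ^ m" using q by (simp add: powr_power powr_powr powr_realpow[symmetric] mult.commute)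
    also have "q powr \<sigma> = \<gamma>" using q \<gamma> by (simp add: \<sigma>_def powr_def)
    finally show ?thesis .
  qed
  \<comment> \<open>The positive summand gives also the sets of diameter 0 a level, with finitely many sets to each.\<close>
  define w where "w = (\<lambda>i. diameter (U i) powr \<sigma> + \<eta> / 2 ^ Suc i)"
  have w0: "0 < w i" for i using \<eta> by (simp add: w_def add_nonneg_pos)
  have half: "(\<Sum>i\<in>J. \<eta> / 2 ^ Suc i) \<le> \<eta>" if "finite J" for J
  proof -
    have "(\<lambda>i. \<eta> * (1 / 2) ^ Suc i) sums (\<eta> * 1)"
      by (intro sums_mult power_half_series)
    then have "(\<lambda>i. \<eta> / 2 ^ Suc i) sums \<eta>" by (simp add: power_one_over)
    then show ?thesis
      using sum_le_suminf[of "\<lambda>i. \<eta> / 2 ^ Suc i" J] that \<eta> by (auto simp: sums_iff)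
  qed
  have sumw: "sum w J \<le> 2 * \<eta>" if "finite J" for J
    using sum[OF that] half[OF that] by (simp add: w_def sum.distrib \<sigma>_def)
  have "\<exists>m. \<gamma> ^ m * w i \<le> s powr \<sigma> \<and> s powr \<sigma> < \<gamma> ^ Suc m * w i" for i
  proof -
    let ?P = "\<lambda>m. s powr \<sigma> < \<gamma> ^ m * w i"
    obtain n where "s powr \<sigma> / w i < \<gamma> ^ n" using real_arch_pow[OF \<gamma>] by blast
    then have Pn: "?P n" using w0[of i] by (simp add: field_simps)
    have "\<not> ?P 0" using sumw[of "{i}"] \<eta> by (simp add: \<sigma>_def)
    then obtain m where "?P (Suc m)" "\<not> ?P m"
      using Pn ex_least_nat_less[of ?P n] by blast
    then show ?thesis by (intro exI[of _ m]) auto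
  qed
  then obtain lev where lev: "\<And>i. \<gamma> ^ lev i * w i \<le> s powr \<sigma>" "\<And>i. s powr \<sigma> < \<gamma> ^ Suc (lev i) * w i"
    by metis
  have fin: "real (card J) * s powr \<sigma> \<le> 2 * \<eta> * \<gamma> ^ (m + 1)" if J: "finite J" "J \<subseteq> {i. lev i = m}" for J m
  proof -
    have "real (card J) * s powr \<sigma> = (\<Sum>i\<in>J. s powr \<sigma>)" by simp
    also have "\<dots> \<le> (\<Sum>i\<in>J. \<gamma> ^ (m + 1) * w i)"
      using J lev(2) by (intro sum_mono) (force intro: less_imp_le)
    also have "\<dots> = \<gamma> ^ (m + 1) * sum w J" by (simp add: sum_distrib_left)
    also have "\<dots> \<le> \<gamma> ^ (m + 1) * (2 * \<eta>)" using sumw[OF J(1)] \<gamma> by (intro mult_left_mono) auto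
    finally show ?thesis by (simp add: mult_ac)
  qed
  show thesis
  proof (rule that[of lev])
    fix i
    have "diameter (U i) powr \<sigma> \<le> w i" using \<eta> by (simp add: w_def)
    also have "w i \<le> s powr \<sigma> / \<gamma> ^ lev i" using lev(1)[of i] \<gamma> by (simp add: field_simps)
    also have "\<dots> = (s / q ^ lev i) powr \<sigma>" using s q by (simp add: powr_divide q\<sigma>)
    finally have "diameter (U i) powr \<sigma> \<le> (s / q ^ lev i) powr \<sigma>" .
    moreover have "0 \<le> s / q ^ lev i" using s q by simp
    ultimately show "diameter (U i) \<le> s / q ^ lev i"
      using powr_less_mono2[OF \<sigma>, of "s / q ^ lev i" "diameter (U i)"] by (meson not_le)
  next
    fix m
    have s0: "0 < s powr \<sigma>" using s by simp
    show f: "finite {i. lev i = m}"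
    proof (rule ccontr)
      assume "infinite {i. lev i = m}"
      then obtain J where J: "J \<subseteq> {i. lev i = m}" "finite J"
          "card J = Suc (nat \<lceil>2 * \<eta> * \<gamma> ^ (m + 1) / s powr \<sigma>\<rceil>)"
        by (meson infinite_arbitrarily_large)
      then have "2 * \<eta> * \<gamma> ^ (m + 1) / s powr \<sigma> < real (card J)" by linarith
      then show False using fin[OF J(2,1)] s0 by (simp add: field_simps)
    qed
    show "real (card {i. lev i = m}) * s powr (ln \<gamma> / ln q) \<le> 2 * \<eta> * \<gamma> ^ (m + 1)"
      using fin[OF f] by (simp add: \<sigma>_def)
  qed
qed

text \<open>A cover of the set of points that avoid all obstacles is treated as a further family of
  sets to be avoided. If the cover is cheap, then a point avoiding both exists, and it is not covered.\<close>
lemma avoiding_set_hausdorff_dim_pos: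
  fixes p :: "'a::euclidean_space" and F :: "'i \<Rightarrow> 'a set set"
  assumes I: "finite I" and s: "0 < s" and q: "1 < q" and L: "1 \<le> L" and \<theta>: "0 < \<theta>"
    and bdd: "\<And>a U. a \<in> I \<Longrightarrow> U \<in> F a \<Longrightarrow> bounded U"
    and big: "\<And>a U. a \<in> I \<Longrightarrow> U \<in> F a \<Longrightarrow> diameter U \<le> \<theta> * real q"
    and sep: "\<And>a m R U U'. \<lbrakk>a \<in> I; U \<in> F a; U' \<in> F a;
        U \<inter> grid_cube p (s / real q ^ m) R \<noteq> {}; U' \<inter> grid_cube p (s / real q ^ m) R \<noteq> {};
        \<theta> / real q ^ m < diameter U; \<theta> / real q ^ m < diameter U'\<rbrakk> \<Longrightarrow> U = U'"
    and W: "\<theta> * real q ^ (L + 1) \<le> real W * s"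
    and \<epsilon>: "0 < \<epsilon>" "\<epsilon> < 1" and \<gamma>: "\<gamma> = (1 - \<epsilon>) * real q ^ DIM('a)" "1 < \<gamma>"
    and few: "2 * (real (card I) * real (2 * W + 3) ^ DIM('a)) \<le> \<epsilon> * real q ^ DIM('a) * \<gamma> ^ (L - 1)"
  shows "0 < hausdorff_dim {x \<in> grid_cube p s (\<lambda>b\<in>Basis. 0).
    \<forall>a\<in>I. \<forall>U\<in>F a. 0 < diameter U \<longrightarrow> x \<notin> U}" (is "0 < hausdorff_dim ?X")
proof -
  define \<sigma> where "\<sigma> = ln \<gamma> / ln (real q)"
  define \<eta> where "\<eta> = \<epsilon> * s powr \<sigma> / (4 * 5 ^ DIM('a) * \<gamma>)"
  have \<sigma>: "0 < \<sigma>" using q \<gamma> by (simp add: \<sigma>_def)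
  have \<eta>: "0 < \<eta>" using \<epsilon> s \<gamma>(2) by (simp add: \<eta>_def)
  have c1: "1 \<le> 2 * 5 ^ DIM('a) * \<gamma>"
    
  proof -
    have "(1::real) \<le> 5 ^ DIM('a)" by simp
    then have "(1::real) * 1 \<le> (2 * 5 ^ DIM('a)) * \<gamma>" using \<gamma>(2) by (intro mult_mono) linarith+
    then show ?thesis by simp
  qed
  have \<eta>2: "2 * \<eta> \<le> s powr \<sigma>"
  proof -
    have "2 * \<eta> * 1 \<le> 2 * \<eta> * (2 * 5 ^ DIM('a) * \<gamma>)" using c1 \<eta> by (intro mult_left_mono) auto
    also have "\<dots> = \<epsilon> * s powr \<sigma>" using \<gamma>(2) by (simp add: \<eta>_def field_simps)
    also have "\<dots> \<le> 1 * s powr \<sigma>" using \<epsilon> by (intro mult_right_mono) auto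
    finally show ?thesis by simp
  qed
  show ?thesis
  proof (rule hausdorff_dim_posI[OF \<sigma> \<eta>])
    fix V :: "nat \<Rightarrow> 'a set"
    assume V: "\<And>i. bounded (V i)" "\<And>J. finite J \<Longrightarrow> (\<Sum>i\<in>J. diameter (V i) powr \<sigma>) \<le> \<eta>"
    obtain lev where lev: "\<And>i. diameter (V i) \<le> s / real q ^ lev i" "\<And>m. finite {i. lev i = m}"
      "\<And>m. real (card {i. lev i = m}) * s powr \<sigma> \<le> 2 * \<eta> * \<gamma> ^ (m + 1)"
      using assign_levels[of s "real q" \<gamma> \<eta> V] s q \<gamma>(2) \<eta> \<eta>2 V unfolding \<sigma>_def by auto
    have few_V: "2 * 5 ^ DIM('a) * real (card {i. lev i = m}) \<le> \<epsilon> * \<gamma> ^ m" for m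
    proof -
      have "2 * 5 ^ DIM('a) * real (card {i. lev i = m}) * s powr \<sigma>
          \<le> 2 * 5 ^ DIM('a) * (2 * \<eta> * \<gamma> ^ (m + 1))"
        using mult_left_mono[OF lev(3)[of m], of "2 * 5 ^ DIM('a)"] by (simp only: mult.assoc) simp
      also have "\<dots> = \<epsilon> * \<gamma> ^ m * s powr \<sigma>"
        using \<gamma>(2) by (simp add: \<eta>_def field_simps)
      finally show ?thesis using s by (simp add: mult_le_cancel_right)
    qed
    have "\<exists>x\<in>grid_cube p s (\<lambda>b\<in>Basis. 0).
        (\<forall>i. x \<notin> V i) \<and> (\<forall>a\<in>I. \<forall>U\<in>F a. 0 < diameter U \<longrightarrow> x \<notin> U)"
      by (rule exists_point_avoiding[where W=W and L=L and lev=lev and q=q and \<theta>=\<theta> and \<gamma>=\<gamma> and \<epsilon>=\<epsilon>,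
          OF I s q L \<theta> bdd big sep W \<epsilon> \<gamma>(1) few V(1) lev(1,2) few_V])
    then show "\<not> ?X \<subseteq> (\<Union>i. V i)" by blast
  qed
qed

lemma hausdorff_dim_mono:
  fixes X Y :: "'a::metric_space set"
  assumes "X \<subseteq> Y"
  shows "hausdorff_dim X \<le> hausdorff_dim Y"
proof -
  have "hausdorff_premeasure t \<delta> X \<le> hausdorff_premeasure t \<delta> Y" for t \<delta>
    unfolding hausdorff_premeasure_def using assms by (intro Inf_superset_mono) blast
  then have "hausdorff_outer_measure t X \<le> hausdorff_outer_measure t Y" for t
    unfolding hausdorff_outer_measure_def by (intro SUP_mono) blast
  then have "hausdorff_outer_measure t Y = 0 \<Longrightarrow> hausdorff_outer_measure t X = 0" for t
    by (metis le_zero_eq)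
  then show ?thesis
    unfolding hausdorff_dim_def by (intro Inf_superset_mono) blast
qed

lemma hausdorff_dim_empty: "hausdorff_dim ({} :: 'a::metric_space set) = 0"
proof -
  have pre: "hausdorff_premeasure t \<delta> ({} :: 'a set) = 0" if "0 < \<delta>" for t \<delta>
  proof -
    have "hausdorff_premeasure t \<delta> ({} :: 'a set) \<le> (\<Sum>i::nat. ennreal (diameter ({} :: 'a set) powr t))"
      unfolding hausdorff_premeasure_def using that
      by (intro Inf_lower CollectI exI[of _ "\<lambda>_::nat. {}"]) auto
    then show ?thesis by simp
  qed
  have "hausdorff_outer_measure t ({} :: 'a set) = 0" for t
    unfolding hausdorff_outer_measure_def
    by (intro antisym SUP_least) (auto simp: pre)
  then have "hausdorff_dim ({} :: 'a set) \<le> ennreal t" if "0 < t" for t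
    unfolding hausdorff_dim_def using that by (intro Inf_lower) auto
  then have "hausdorff_dim ({} :: 'a set) \<le> 0 + ennreal t" if "0 < t" for t
    using that by simp
  then show ?thesis
    by (metis ennreal_le_epsilon le_zero_eq)
qed

section \<open>Thickness and the gaps\<close>

text \<open>Any two gaps are at distance at least \<open>\<tau>\<close> times the smaller of their diameters, in whatever order
  they are listed. All that is needed of thickness follows from these two inequalities.\<close>
lemma thickness_separation:
  fixes C :: "'a::euclidean_space set"
  assumes C: "compact C" and th: "thickness C = ereal \<tau>" "0 < \<tau>"
  shows thickness_gap_gap: "\<And>U U' x y. \<lbrakk>U \<in> bounded_gaps C; U' \<in> bounded_gaps C; U \<noteq> U'; x \<in> U; y \<in> U'\<rbrakk>
      \<Longrightarrow> \<tau> * min (diameter U) (diameter U') \<le> dist x y"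
    and thickness_gap_outer: "\<And>U x y. \<lbrakk>U \<in> bounded_gaps C; x \<in> U; y \<in> outer_component C\<rbrakk>
      \<Longrightarrow> \<tau> * diameter U \<le> dist x y"
proof -
  have ne: "bounded_gaps C \<noteq> {}"
    using th by (auto simp: thickness_def split: if_splits)
  then have "\<exists>I G. gap_enumeration C I G"
    using th by (auto simp: thickness_def split: if_splits)
  then obtain I G where G: "gap_enumeration C I G" by blast
  have imG: "G ` I = bounded_gaps C"
    using G by (simp add: gap_enumeration_def bij_betw_def)
  have bdd: "bounded (G n)" if "n \<in> I" for n
    using G that by (auto simp: gap_enumeration_def bij_betw_def bounded_gaps_def)
  have key: "\<tau> * diameter (G n) \<le> dist x y"
    if "n \<in> I" "x \<in> G n" "y \<in> (\<Union>i<n. G i) \<union> outer_component C" for n x y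
  proof (cases "diameter (G n) = 0")
    case False
    then have d: "0 < diameter (G n)" using diameter_ge_0[OF bdd[OF that(1)]] by simp
    have "ereal \<tau> \<le> ereal (gap_ratio C G n)"
      using thickness_eq_Inf[OF C ne G] th that(1) by (metis INF_lower)
    then have "\<tau> * diameter (G n) \<le> setdist (G n) ((\<Union>i<n. G i) \<union> outer_component C)"
      using d by (simp add: gap_ratio_def le_divide_eq)
    also have "\<dots> \<le> dist x y" using that by (intro setdist_le_dist)
    finally show ?thesis .
  qed simp
  have ex: "\<exists>n\<in>I. U = G n" if "U \<in> bounded_gaps C" for U
    using imG that by blast
  show "\<tau> * diameter U \<le> dist x y" if "U \<in> bounded_gaps C" "x \<in> U" "y \<in> outer_component C" for U x y
    using ex[OF that(1)] key that by blast
  show "\<tau> * min (diameter U) (diameter U') \<le> dist x y"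
    if U: "U \<in> bounded_gaps C" "U' \<in> bounded_gaps C" "U \<noteq> U'" "x \<in> U" "y \<in> U'" for U U' x y
  proof -
    obtain n n' where n: "n \<in> I" "U = G n" "n' \<in> I" "U' = G n'" using ex U by metis
    then consider "n' < n" | "n < n'" using U(3) by (metis linorder_neqE_nat)
    then show ?thesis
    proof cases
      case 1
      then have "\<tau> * diameter U \<le> dist x y" using key[of n x y] n U by auto
      then show ?thesis using th(2) by (smt (verit) mult_left_mono)
    next
      case 2
      then have "\<tau> * diameter U' \<le> dist y x" using key[of n' y x] n U by auto
      then show ?thesis using th(2) by (smt (verit) mult_left_mono dist_commute)
    qed
  qed
qed

lemma bounded_gap_diameter_pos:
  fixes C :: "'a::euclidean_space set"
  assumes "compact C" "U \<in> bounded_gaps C"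
  shows "0 < diameter U"
proof -
  have U: "open U" "bounded U" "U \<noteq> {}"
    using assms in_components_nonempty open_components[of "- C" U]
    by (auto simp: bounded_gaps_eq_components compact_imp_closed open_Compl)
  have "\<not> U \<subseteq> {x}" for x
    using U not_open_singleton[of x] by (metis subset_singletonD)
  with U(3) obtain x y where "x \<in> U" "y \<in> U" "x \<noteq> y" by blast
  then have "0 < dist x y" "dist x y \<le> diameter U" using diameter_bounded_bound U(2) by auto
  then show ?thesis by linarith
qed

lemma dist_convex_hull_le:
  fixes C :: "'a::real_normed_vector set"
  assumes C: "bounded C" and xy: "x \<in> convex hull C" "y \<in> convex hull C"
  shows "dist x y \<le> diameter C"
proof -
  have "convex hull C \<subseteq> cball c (diameter C)" if "c \<in> C" for c
    using diameter_bounded_bound[OF C that] by (intro hull_minimal) auto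
  then have "C \<subseteq> cball x (diameter C)"
    using xy(1) by (metis dist_commute mem_cball subset_iff)
  then have "convex hull C \<subseteq> cball x (diameter C)" by (intro hull_minimal) auto
  then show ?thesis using xy(2) by auto
qed

text \<open>A gap lies in the convex hull of \<open>C\<close>, and points just over \<open>diameter C\<close> away from one of its points
  are outside the convex hull, hence in the outer component.\<close>
lemma thickness_gap_diameter_le:
  fixes C :: "'a::euclidean_space set"
  assumes C: "compact C" and th: "thickness C = ereal \<tau>" "0 < \<tau>" and U: "U \<in> bounded_gaps C"
  shows "\<tau> * diameter U \<le> diameter C"
proof -
  let ?H = "convex hull C"
  obtain x where x: "x \<in> U" using U by (auto simp: bounded_gaps_def intro: path_component_refl)
  have outer: "- ?H \<subseteq> outer_component C"
    using outside_subset_convex[of ?H C] by (simp add: outer_component_eq_outside[OF C] hull_subset)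
  have xH: "x \<in> ?H"
  proof (rule ccontr)
    assume "x \<notin> ?H"
    then have "\<tau> * diameter U \<le> dist x x"
      using outer by (intro thickness_gap_outer[OF C th U x]) auto
    then show False using bounded_gap_diameter_pos[OF C U] th(2) by (simp add: mult_le_0_iff)
  qed
  have "\<tau> * diameter U \<le> diameter C + e" if e: "0 < e" for e
  proof -
    obtain b :: 'a where b: "norm b = diameter C + e"
      using vector_choose_size[of "diameter C + e"] e diameter_ge_0[OF compact_imp_bounded[OF C]] by auto
    have "x + b \<notin> ?H"
    proof
      assume "x + b \<in> ?H"
      then have "dist x (x + b) \<le> diameter C"
        by (rule dist_convex_hull_le[OF compact_imp_bounded[OF C] xH])
      then show False using b e by (simp add: dist_norm)
    qed
    then have "x + b \<in> outer_component C" using outer by blast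
    then have "\<tau> * diameter U \<le> dist x (x + b)" by (rule thickness_gap_outer[OF C th U x])
    then show ?thesis using b by (simp add: dist_norm)
  qed
  then show ?thesis by (rule field_le_epsilon)
qed

section \<open>Choice of the parameters\<close>

text \<open>A crude lower bound for \<open>K2\<close>, and the only property of this constant that matters.\<close>
lemma K2_ge:
  assumes "1 \<le> d"
  shows "4 * (96 * sqrt (real d)) ^ d \<le> K2 d"
proof -
  let ?x = "(24 * sqrt (real d)) ^ d"
  have D: "1 \<le> sqrt (real d)" using assms by simp
  have half: "0 < 1 - 1 / (2::real) ^ d" "1 - 1 / 2 ^ d \<le> (1::real)"
    using assms one_less_power[of "2::real" d] by auto
  have 96: "1 \<le> (96 * sqrt (real d)) ^ d" using D by (intro one_le_power) linarith
  have "2 * (96 * sqrt (real d)) ^ d = ?x * (4 ^ d * 2)"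
    using power_mult_distrib[of "24 * sqrt (real d)" 4 d] by simp
  also have "\<dots> \<le> ?x * (1 + 4 ^ d * 2)" by (intro mult_left_mono) auto
  also have "\<dots> \<le> ?x * (1 + 4 ^ d * 2) / (1 - 1 / 2 ^ d)"
    using half divide_left_mono[of "1 - 1 / 2 ^ d" 1 "?x * (1 + 4 ^ d * 2)"] by simp
  finally have "(2 * (96 * sqrt (real d)) ^ d)\<^sup>2 \<le> K2 d"
    unfolding K2_def by (rule power_mono) simp
  moreover have "4 * (96 * sqrt (real d)) ^ d * 1 \<le> 4 * (96 * sqrt (real d)) ^ d * (96 * sqrt (real d)) ^ d"
    using 96 by (intro mult_left_mono) auto
  moreover have "(2 * (96 * sqrt (real d)) ^ d)\<^sup>2 = 4 * (96 * sqrt (real d)) ^ d * (96 * sqrt (real d)) ^ d"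
    by (simp add: power2_eq_square)
  ultimately show ?thesis by linarith
qed

lemma exp_minus_one_le_power:
  assumes "1 \<le> L"
  shows "exp (-1) \<le> (1 - 1 / (real L + 1)) ^ (L - 1)"
proof -
  have L: "1 \<le> real L" using assms by simp
  have "exp (- (1 / real L)) \<le> 1 - 1 / (real L + 1)"
  proof -
    have "1 + 1 / real L \<le> exp (1 / real L)" by (rule exp_ge_add_one_self)
    then have "inverse (exp (1 / real L)) \<le> inverse (1 + 1 / real L)"
      using L by (intro le_imp_inverse_le) (auto intro: add_pos_nonneg)
    also have "\<dots> = 1 - 1 / (real L + 1)" using L by (simp add: field_simps)
    finally show ?thesis by (simp add: exp_minus)
  qed
  then have "exp (- (1 / real L)) ^ (L - 1) \<le> (1 - 1 / (real L + 1)) ^ (L - 1)"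
    by (intro power_mono) auto
  moreover have "exp (- (1 / real L)) ^ (L - 1) = exp (real (L - 1) * - (1 / real L))"
    by (rule exp_of_nat_mult[symmetric])
  moreover have "-1 \<le> real (L - 1) * - (1 / real L)"
    using L assms by (simp add: field_simps of_nat_diff)
  then have "exp (-1) \<le> exp (real (L - 1) * - (1 / real L))" by (simp only: exp_le_cancel_iff)
  ultimately show ?thesis by linarith
qed

text \<open>If the bound on the number of points is at least 1, then \<open>\<tau>\<close> is large compared with \<open>1 / \<beta>\<close>. Here the
  range of \<open>\<tau>\<close> enters: $t^d / \log t$ is increasing for $t \geq e^{1/d}$, so \<open>\<tau> < 1 / \<beta>\<close> would make the
  bound at most $1 / (e K_2) < 1$.\<close>
lemma ln_bounds_of_max_points:
  fixes d n :: nat and \<beta> \<tau> :: real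
  assumes d: "1 \<le> d" and n: "1 \<le> n" and \<beta>: "0 < \<beta>" "\<beta> \<le> 1 / 4"
    and \<tau>: "0 < \<tau>" "\<tau> \<noteq> 1" "\<tau> \<notin> {1<..<exp (1 / real d)}"
    and le: "int n \<le> max_points d \<beta> \<tau>"
  shows "1 < \<tau>" "real n * (exp 1 * K2 d) * ln \<tau> \<le> (\<beta> * \<tau>) ^ d * ln (1 / \<beta>)"
    "96 * sqrt (real d) \<le> \<beta> * \<tau>"
proof -
  have l\<beta>: "\<bar>ln \<beta>\<bar> = ln (1 / \<beta>)" "0 < ln (1 / \<beta>)" using \<beta> by (auto simp: ln_div)
  have K: "4 * (96 * sqrt (real d)) ^ d \<le> K2 d" by (rule K2_ge[OF d])
  have K0: "0 < exp 1 * K2 d" using K d by (smt (verit) exp_gt_zero mult_pos_pos real_sqrt_gt_zero of_nat_0_less_iff zero_less_power One_nat_def Suc_le_lessD)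
  have v: "real n \<le> \<beta> ^ d * ln (1 / \<beta>) / (exp 1 * K2 d) * (\<tau> ^ d / ln \<tau>)"
    using le unfolding max_points_def l\<beta> le_floor_iff by simp
  show \<tau>1: "1 < \<tau>"
  proof (rule ccontr)
    assume "\<not> 1 < \<tau>"
    then have "ln \<tau> \<le> 0" using \<tau> by simp
    then have "\<beta> ^ d * ln (1 / \<beta>) / (exp 1 * K2 d) * (\<tau> ^ d / ln \<tau>) \<le> 0"
      using \<beta> \<tau> l\<beta> K0 by (intro mult_nonneg_nonpos divide_nonneg_nonpos divide_nonneg_pos mult_nonneg_nonneg) auto
    then show False using v n by linarith
  qed
  then have l\<tau>: "0 < ln \<tau>" by simp
  show main: "real n * (exp 1 * K2 d) * ln \<tau> \<le> (\<beta> * \<tau>) ^ d * ln (1 / \<beta>)"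
  proof -
    have "real n * (exp 1 * K2 d * ln \<tau>) \<le>
        \<beta> ^ d * ln (1 / \<beta>) / (exp 1 * K2 d) * (\<tau> ^ d / ln \<tau>) * (exp 1 * K2 d * ln \<tau>)"
      using v K0 l\<tau> by (intro mult_right_mono) auto
    also have "\<dots> = (\<beta> * \<tau>) ^ d * ln (1 / \<beta>)"
    proof -
      have "K2 d \<noteq> 0" using K0 by auto
      then show ?thesis using l\<tau> by (simp add: power_mult_distrib)
    qed
    finally show ?thesis by (simp add: mult.assoc)
  qed
  have "1 * (exp 1 * K2 d) \<le> real n * (exp 1 * K2 d)"
    using n K0 by (intro mult_right_mono) auto
  then have nK: "exp 1 * K2 d * ln \<tau> \<le> (\<beta> * \<tau>) ^ d * ln (1 / \<beta>)"
    using main l\<tau> by (smt (verit) mult_right_mono)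
  have e1: "(1::real) \<le> exp 1" by simp
  have "1 \<le> sqrt (real d)" using d by simp
  then have D1: "1 \<le> (96 * sqrt (real d)) ^ d" by (intro one_le_power) linarith
  have "4 \<le> K2 d" using K D1 by simp
  then have eK: "K2 d \<le> exp 1 * K2 d" using mult_right_mono[OF e1, of "K2 d"] by simp
  have "1 / \<beta> \<le> \<tau>"
  proof (rule ccontr)
    assume "\<not> 1 / \<beta> \<le> \<tau>"
    define u where "u = 1 / (\<beta> * \<tau>)"
    have u: "1 < u" "0 < \<beta> * \<tau>" using \<open>\<not> 1 / \<beta> \<le> \<tau>\<close> \<beta> \<tau> by (auto simp: u_def field_simps)
    have "exp (1 / real d) \<le> \<tau>" using \<tau> \<tau>1 by auto
    then have "1 / real d \<le> ln \<tau>" using \<tau>(1) by (simp add: ln_ge_iff)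
    then have dl: "1 \<le> real d * ln \<tau>" using d by (simp add: field_simps)
    have "ln (1 / \<beta>) = ln \<tau> + ln u"
      using \<beta> \<tau> by (simp add: u_def ln_div ln_mult)
    also have "\<dots> \<le> ln \<tau> + (real d * ln \<tau>) * ln u"
      using mult_right_mono[OF dl, of "ln u"] u by simp
    also have "\<dots> = (1 + ln (u ^ d)) * ln \<tau>"
      using u by (simp add: ln_realpow algebra_simps)
    also have "\<dots> \<le> u ^ d * ln \<tau>"
      using ln_le_minus_one[of "u ^ d"] u l\<tau> by (intro mult_right_mono) auto
    finally have "(\<beta> * \<tau>) ^ d * ln (1 / \<beta>) \<le> (\<beta> * \<tau>) ^ d * (u ^ d * ln \<tau>)"
      using u by (intro mult_left_mono) auto
    also have "\<dots> = ln \<tau>"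
      using u \<beta> \<tau> by (simp add: u_def power_one_over flip: power_mult_distrib mult.assoc)
    finally have "exp 1 * K2 d * ln \<tau> \<le> 1 * ln \<tau>" using nK by simp
    then have "exp 1 * K2 d \<le> 1" using l\<tau> by (simp only: mult_le_cancel_right_pos)
    then show False using eK \<open>4 \<le> K2 d\<close> by simp
  qed
  then have "ln (1 / \<beta>) \<le> ln \<tau>" using \<beta> \<tau> by (subst ln_le_cancel_iff) auto
  then have "(\<beta> * \<tau>) ^ d * ln (1 / \<beta>) \<le> (\<beta> * \<tau>) ^ d * ln \<tau>"
    using \<beta> \<tau> by (intro mult_left_mono) auto
  then have "exp 1 * K2 d * ln \<tau> \<le> (\<beta> * \<tau>) ^ d * ln \<tau>" using nK by simp
  then have "exp 1 * K2 d \<le> (\<beta> * \<tau>) ^ d" using l\<tau> by (simp only: mult_le_cancel_right_pos)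
  then have "(96 * sqrt (real d)) ^ d \<le> (\<beta> * \<tau>) ^ d" using eK K D1 by linarith
  then show "96 * sqrt (real d) \<le> \<beta> * \<tau>"
    using d \<beta> \<tau> by (subst (asm) power_mono_iff) auto
qed

text \<open>The choice of the subdivision factor \<open>q\<close>, the delay \<open>L\<close> and the width \<open>W\<close>. The delay is the first
  level at which the cubes are no longer larger than the obstacles noticed at level 0 may be, so it is about
  $\log \tau / \log q$. With $\epsilon = 1 / (L + 1)$ the factor $(1 - \epsilon)^{L-1}$ is at least $1/e$, and
  the number of points allowed is, up to a factor depending on \<open>d\<close> only, $q^{-d} \tau^d / (e (L + 1))$, which gives the shape of
  \<open>max_points\<close>.\<close>
lemma grid_parameters_exist:
  fixes d n :: nat and \<beta> \<tau> :: real
  assumes d: "1 \<le> d" and n: "1 \<le> n" and \<beta>: "0 < \<beta>" "\<beta> \<le> 1 / 4"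
    and \<tau>: "0 < \<tau>" "\<tau> \<noteq> 1" "\<tau> \<notin> {1<..<exp (1 / real d)}"
    and le: "int n \<le> max_points d \<beta> \<tau>"
  obtains q L W :: nat where "1 / \<beta> \<le> real q" "4 \<le> q" "1 \<le> L"
    "4 * sqrt (real d) * real q ^ (L + 1) \<le> real W * \<tau>"
    "2 * (real n * real (2 * W + 3) ^ d)
      \<le> 1 / (real L + 1) * real q ^ d * ((1 - 1 / (real L + 1)) * real q ^ d) ^ (L - 1)"
proof -
  define D where "D = sqrt (real d)"
  have D: "1 \<le> D" using d by (simp add: D_def)
  note bounds = ln_bounds_of_max_points[OF assms]
  have \<beta>\<tau>: "96 * D \<le> \<beta> * \<tau>" "0 < \<beta> * \<tau>" using bounds(3) D by (auto simp: D_def \<beta> \<tau>)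
  have l\<tau>: "0 < ln \<tau>" and l\<beta>: "0 < ln (1 / \<beta>)" using bounds(1) \<beta> by (auto simp: ln_div)
  define q where "q = nat \<lceil>1 / \<beta>\<rceil>"
  have b4: "4 \<le> 1 / \<beta>" using \<beta> by (simp add: field_simps)
  have q: "1 / \<beta> \<le> real q" "real q \<le> 2 / \<beta>"
    using b4 by (auto simp: q_def of_nat_nat ceiling_le_iff) linarith+
  have q4: "4 \<le> real q" using q b4 by linarith
  let ?P = "\<lambda>m. \<tau> \<le> 4 * D * real q ^ (m + 1)"
  obtain m where "\<tau> < real q ^ m" using real_arch_pow[of "real q" \<tau>] q4 by auto
  moreover have "1 * real q ^ m \<le> (4 * D) * real q ^ (m + 1)"
    using D q4 by (intro mult_mono power_increasing) auto
  ultimately have Pm: "?P m" by simp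
  have nP0: "\<not> ?P 0"
  proof -
    have "4 * D * real q \<le> 4 * D * (2 / \<beta>)" using q D by (intro mult_left_mono) auto
    also have "\<dots> < \<tau>" using \<beta>\<tau> \<beta> D by (simp add: field_simps)
    finally show ?thesis by simp
  qed
  obtain L' where L': "?P (Suc L')" "\<not> ?P L'" using ex_least_nat_less[of ?P m] Pm nP0 by blast
  define L where "L = Suc L'"
  have L1: "1 \<le> L" by (simp add: L_def)
  have PL: "\<tau> \<le> 4 * D * real q ^ (L + 1)" and qL: "4 * D * real q ^ L < \<tau>"
    using L' by (auto simp: L_def)
  have Lln: "(real L + 1) * ln (1 / \<beta>) \<le> 2 * ln \<tau>"
  proof -
    have "1 * real q ^ L \<le> 4 * D * real q ^ L" using D by (intro mult_right_mono) auto
    then have "real q ^ L \<le> \<tau>" using qL by simp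
    then have "ln (real q ^ L) \<le> ln \<tau>" using q4 \<tau> by (subst ln_le_cancel_iff) auto
    then have "real L * ln (real q) \<le> ln \<tau>" using q4 by (simp add: ln_realpow)
    moreover have "ln (1 / \<beta>) \<le> ln (real q)" using q \<beta> q4 by (subst ln_le_cancel_iff) auto
    then have "real L * ln (1 / \<beta>) \<le> real L * ln (real q)" by (intro mult_left_mono) auto
    moreover have "1 * ln (1 / \<beta>) \<le> real L * ln (1 / \<beta>)" using L1 l\<beta> by (intro mult_right_mono) auto
    ultimately show ?thesis by (simp add: algebra_simps)
  qed
  define y where "y = 4 * D * real q ^ (L + 1) / \<tau>"
  have y: "1 \<le> y" using PL \<tau> by (simp add: y_def field_simps)
  define W where "W = nat \<lceil>y\<rceil>"
  have W: "y \<le> real W" "real W \<le> y + 1" using y by (auto simp: W_def)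
  have cell: "real (2 * W + 3) \<le> 60 * D / (\<beta> * \<tau>) * real q ^ L"
  proof -
    have "real (2 * W + 3) \<le> 7 * y" using W y by simp
    also have "\<dots> = 28 * D * real q ^ L / \<tau> * real q" by (simp add: y_def field_simps)
    also have "\<dots> \<le> 28 * D * real q ^ L / \<tau> * (2 / \<beta>)"
      using q D \<tau> by (intro mult_left_mono) auto
    also have "\<dots> = 56 * (D * real q ^ L / (\<beta> * \<tau>))" by (simp add: field_simps)
    also have "\<dots> \<le> 60 * (D * real q ^ L / (\<beta> * \<tau>))"
      using D \<beta> \<tau> by (intro mult_right_mono) auto
    finally show ?thesis by (simp add: field_simps)
  qed
  have num: "2 * exp 1 * (real L + 1) * (real n * (60 * D) ^ d) \<le> (\<beta> * \<tau>) ^ d"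
  proof -
    have "4 * (60 * D) ^ d \<le> 4 * (96 * D) ^ d" using D by (intro mult_left_mono power_mono) auto
    also have "\<dots> \<le> K2 d" using K2_ge[OF d] by (simp add: D_def)
    finally have K: "4 * (60 * D) ^ d \<le> K2 d" .
    have "2 * exp 1 * (real L + 1) * (real n * (60 * D) ^ d) * ln (1 / \<beta>)
        = ((real L + 1) * ln (1 / \<beta>)) * (2 * (exp 1 * real n * (60 * D) ^ d))" by (simp add: mult_ac)
    also have "\<dots> \<le> (2 * ln \<tau>) * (2 * (exp 1 * real n * (60 * D) ^ d))"
      using Lln D by (intro mult_right_mono) auto
    also have "\<dots> = exp 1 * real n * ln \<tau> * (4 * (60 * D) ^ d)" by (simp add: mult_ac)
    also have "\<dots> \<le> exp 1 * real n * ln \<tau> * K2 d"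
      using K l\<tau> by (intro mult_left_mono) auto
    also have "\<dots> = real n * (exp 1 * K2 d) * ln \<tau>" by (simp add: mult_ac)
    also have "\<dots> \<le> (\<beta> * \<tau>) ^ d * ln (1 / \<beta>)" by (rule bounds(2))
    finally show ?thesis using l\<beta> by (simp only: mult_le_cancel_right_pos)
  qed
  show thesis
  proof (rule that[of q L W])
    show "4 * sqrt (real d) * real q ^ (L + 1) \<le> real W * \<tau>"
      using W(1) \<tau> by (simp add: y_def D_def field_simps)
    have "2 * (real n * real (2 * W + 3) ^ d) \<le> 2 * (real n * (60 * D / (\<beta> * \<tau>) * real q ^ L) ^ d)"
      using cell by (intro mult_left_mono power_mono) auto
    also have "\<dots> = (2 * exp 1 * (real L + 1) * (real n * (60 * D) ^ d)) *
        (exp (-1) / (real L + 1) * (real q ^ L) ^ d / (\<beta> * \<tau>) ^ d)"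
    proof -
      have cancel: "2 * (x * (a * (b / t))) = 2 * E * c * (x * a) * (inverse E / c * b / t)"
        if "E \<noteq> 0" "c \<noteq> 0" for x a b t E c :: real using that by simp
      have "(60 * D / (\<beta> * \<tau>) * real q ^ L) ^ d = (60 * D) ^ d * ((real q ^ L) ^ d / (\<beta> * \<tau>) ^ d)"
        by (simp add: power_mult_distrib power_divide)
      then show ?thesis unfolding exp_minus by (simp only:) (rule cancel, auto)
    qed
    also have "\<dots> \<le> (\<beta> * \<tau>) ^ d * (exp (-1) / (real L + 1) * (real q ^ L) ^ d / (\<beta> * \<tau>) ^ d)"
      using num \<beta>\<tau> by (intro mult_right_mono) auto
    also have "\<dots> = exp (-1) * (1 / (real L + 1) * (real q ^ L) ^ d)"
      using \<beta> \<tau> by simp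
    also have "\<dots> \<le> (1 - 1 / (real L + 1)) ^ (L - 1) * (1 / (real L + 1) * (real q ^ L) ^ d)"
      using exp_minus_one_le_power[OF L1] by (intro mult_right_mono) auto
    also have "(real q ^ L) ^ d = real q ^ d * (real q ^ d) ^ (L - 1)"
    proof -
      have "(real q ^ L) ^ d = (real q ^ d) ^ L" by (simp add: mult.commute flip: power_mult)
      then show ?thesis by (simp add: L_def)
    qed
    also have "x ^ (L - 1) * (y * (z * z ^ (L - 1))) = y * z * (x * z) ^ (L - 1)" for x y z :: real
      by (simp add: power_mult_distrib)
    finally show "2 * (real n * real (2 * W + 3) ^ d)
      \<le> 1 / (real L + 1) * real q ^ d * ((1 - 1 / (real L + 1)) * real q ^ d) ^ (L - 1)" .
  qed (use q q4 L1 in auto)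
qed

section \<open>Translates of a finite pattern\<close>

lemma diameter_translation:
  fixes U :: "'a::euclidean_space set"
  shows "diameter ((\<lambda>u. u - v) ` U) = diameter U"
proof -
  have "((\<lambda>u. u - v) ` U) \<times> ((\<lambda>u. u - v) ` U) = (\<lambda>(x, y). (x - v, y - v)) ` (U \<times> U)"
    by force
  then show ?thesis
    by (simp add: diameter_def image_image case_prod_unfold dist_norm)
qed

lemma complement_point_in_gap:
  fixes C :: "'a::euclidean_space set"
  assumes "y \<notin> C" "y \<notin> outer_component C"
  obtains U where "U \<in> bounded_gaps C" "y \<in> U"
proof -
  let ?U = "path_component_set (- C) y"
  have U: "y \<in> ?U" using assms by (simp add: path_component_refl)
  moreover have "?U \<in> bounded_gaps C"
  proof (rule ccontr)
    assume "?U \<notin> bounded_gaps C"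
    then have "\<not> bounded ?U" using assms by (auto simp: bounded_gaps_def)
    then show False using assms U by (auto simp: outer_component_def)
  qed
  ultimately show thesis using that by blast
qed

text \<open>The case without obstacles. It settles the empty pattern, for which nothing is known about
  \<open>\<beta>\<close> and \<open>\<tau>\<close>.\<close>
lemma hausdorff_dim_UNIV_pos: "0 < hausdorff_dim (UNIV :: 'a::euclidean_space set)"
proof -
  let ?d = "DIM('a)"
  obtain W :: nat where W: "16 \<le> real W" using real_arch_simple by blast
  have "(1::real) * 4 \<le> 4 ^ ?d" by (simp add: self_le_power Suc_le_eq)
  then have "0 < hausdorff_dim {x \<in> grid_cube (0::'a) 1 (\<lambda>b\<in>Basis. 0).
      \<forall>a\<in>({} :: unit set). \<forall>U\<in>{}. 0 < diameter U \<longrightarrow> x \<notin> U}"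
    using W
    by (intro avoiding_set_hausdorff_dim_pos[where \<theta>=1 and q=4 and L=1 and W=W
          and \<epsilon>="1/2" and \<gamma>="(1 - 1/2) * real 4 ^ ?d"]) auto
  then show ?thesis using hausdorff_dim_mono[OF subset_UNIV] by (meson less_le_trans)
qed

text \<open>The obstacles attached to \<open>a \<in> A\<close> are the gaps of \<open>C\<close> translated by \<open>- l *\<^sub>R a\<close>; a point \<open>x\<close> that avoids
  them and for which \<open>x + l *\<^sub>R a\<close> stays in the ball has \<open>x + l *\<^sub>R a \<in> C\<close>.\<close>
lemma translates_hausdorff_dim_pos:
  fixes C :: "'a::euclidean_space set" and A :: "'a set"
  assumes C: "compact C" and th: "thickness C = ereal \<tau>" and \<tau>: "0 < \<tau>" "\<tau> \<noteq> 1"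
      "\<tau> \<notin> {1<..<exp (1 / real DIM('a))}"
    and r: "0 < r" and B: "ball z r \<subseteq> - outer_component C"
    and A: "finite A" "A \<noteq> {}" "int (card A) \<le> max_points DIM('a) (scale_ratio (ball z r) C) \<tau>"
    and l: "0 < l" "diameter A = 0 \<or> l < diameter (ball z r) / (16 * diameter A)"
  shows "0 < hausdorff_dim {x. (\<lambda>a. x + l *\<^sub>R a) ` A \<subseteq> C}"
proof -
  let ?d = "DIM('a)"
  define D where "D = sqrt (real ?d)"
  define \<beta> where "\<beta> = scale_ratio (ball z r) C"
  have D: "1 \<le> D" by (simp add: D_def Suc_le_eq)
  have n: "1 \<le> card A" using A by (simp add: Suc_le_eq card_gt_0_iff)
  have \<beta>: "\<beta> \<le> 1 / 4" "0 \<le> \<beta>" "\<beta> \<noteq> 0"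
  proof -
    show "\<beta> \<le> 1 / 4" "0 \<le> \<beta>" using r diameter_ge_0[OF compact_imp_bounded[OF C]]
      by (auto simp: \<beta>_def scale_ratio_def)
    show "\<beta> \<noteq> 0"
    proof
      assume "\<beta> = 0"
      then show False using A(3) n by (simp add: \<beta>_def[symmetric] max_points_def)
    qed
  qed
  have C0: "0 < diameter C"
    using \<beta>(3) diameter_ge_0[OF compact_imp_bounded[OF C]] by (cases "diameter C = 0") (auto simp: \<beta>_def scale_ratio_def)
  have "\<beta> \<le> 15 * (2 * r) / (16 * diameter C)" using r by (simp add: \<beta>_def scale_ratio_def)
  then have diamC: "diameter C \<le> 2 * r * (1 / \<beta>)" using \<beta> C0 r by (simp add: field_simps)
  obtain q L W where q: "1 / \<beta> \<le> real q" "4 \<le> q" and L: "1 \<le> L"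
    and W: "4 * D * real q ^ (L + 1) \<le> real W * \<tau>"
    and few: "2 * (real (card A) * real (2 * W + 3) ^ ?d)
      \<le> 1 / (real L + 1) * real q ^ ?d * ((1 - 1 / (real L + 1)) * real q ^ ?d) ^ (L - 1)"
    using grid_parameters_exist[of ?d "card A" \<beta> \<tau>] n \<beta> \<tau> A(3) unfolding D_def \<beta>_def[symmetric]
    by (metis DIM_ge_Suc0 One_nat_def order_le_less)
  \<comment> \<open>The starting cube has diameter \<open>r / 2\<close>, and the points \<open>l *\<^sub>R a\<close> are less than \<open>r / 2\<close> apart, so that the
      translates of the cube stay in the ball. The factor 4 in \<open>\<theta>\<close> makes \<open>\<theta> * q\<close> a bound for all gaps.\<close>
  define s where "s = r / (2 * D)"
  define \<theta> where "\<theta> = 4 * D * s / \<tau>"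
  have s: "0 < s" and Ds: "D * s = r / 2" using r D by (auto simp: s_def)
  have \<theta>: "0 < \<theta>" using D s \<tau> by (simp add: \<theta>_def)
  obtain a0 where a0: "a0 \<in> A" using A by blast
  define p where "p = z - l *\<^sub>R a0"
  define F where "F = (\<lambda>a. (\<lambda>U. (\<lambda>u. u - l *\<^sub>R a) ` U) ` bounded_gaps C)"
  define \<epsilon> where "\<epsilon> = 1 / (real L + 1)"
  define X where "X = {x \<in> grid_cube p s (\<lambda>b\<in>Basis. 0). \<forall>a\<in>A. \<forall>U\<in>F a. 0 < diameter U \<longrightarrow> x \<notin> U}"
  have "0 < hausdorff_dim X"
    unfolding X_def
  proof (rule avoiding_set_hausdorff_dim_pos[where \<theta>=\<theta> and q=q and L=L and W=W and \<epsilon>=\<epsilon>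
        and \<gamma>="(1 - \<epsilon>) * real q ^ ?d"])
    show "bounded U" if "U \<in> F a" for a U
      using that by (auto simp: F_def bounded_gaps_def bounded_translation_minus)
    show "diameter U \<le> \<theta> * real q" if U: "U \<in> F a" for a U
    proof -
      obtain G where G: "G \<in> bounded_gaps C" "diameter U = diameter G"
        using U by (auto simp: F_def diameter_translation)
      have "\<tau> * diameter G \<le> diameter C" by (rule thickness_gap_diameter_le[OF C th \<tau>(1) G(1)])
      also have "\<dots> \<le> 2 * r * (1 / \<beta>)" by (rule diamC)
      also have "\<dots> \<le> 2 * r * real q" using q r by (intro mult_left_mono) auto
      also have "\<dots> = \<tau> * (\<theta> * real q)" using \<tau> D by (simp add: \<theta>_def s_def)
      finally show ?thesis using \<tau> G(2) by simp
    qed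
    show "U = U'"
      if U: "U \<in> F a" "U' \<in> F a" "U \<inter> grid_cube p (s / real q ^ m) R \<noteq> {}"
        "U' \<inter> grid_cube p (s / real q ^ m) R \<noteq> {}"
        "\<theta> / real q ^ m < diameter U" "\<theta> / real q ^ m < diameter U'" for a m R U U'
    proof -
      obtain G G' where G: "G \<in> bounded_gaps C" "G' \<in> bounded_gaps C"
        "U = (\<lambda>u. u - l *\<^sub>R a) ` G" "U' = (\<lambda>u. u - l *\<^sub>R a) ` G'"
        using U by (auto simp: F_def)
      obtain g g' where g: "g \<in> G" "g' \<in> G'" "g - l *\<^sub>R a \<in> grid_cube p (s / real q ^ m) R"
        "g' - l *\<^sub>R a \<in> grid_cube p (s / real q ^ m) R" using U(3,4) G(3,4) by blast
      have "dist g g' = dist (g - l *\<^sub>R a) (g' - l *\<^sub>R a)" by (simp add: dist_norm)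
      also have "\<dots> \<le> D * (s / real q ^ m)"
        unfolding D_def using g s by (intro dist_grid_cube_le) auto
      also have "\<dots> < 4 * (D * (s / real q ^ m))"
      proof -
        have "0 < D * (s / real q ^ m)" using D s q by simp
        then show ?thesis by linarith
      qed
      also have "\<dots> = \<tau> * (\<theta> / real q ^ m)" using \<tau> by (simp add: \<theta>_def)
      also have "\<dots> < \<tau> * min (diameter G) (diameter G')"
        using U(5,6) \<tau>(1) by (intro mult_strict_left_mono) (auto simp: G diameter_translation)
      finally have "G = G'"
        using thickness_gap_gap[OF C th \<tau>(1) G(1,2) _ g(1,2)] by fastforce
      then show ?thesis by (simp add: G)
    qed
    show "\<theta> * real q ^ (L + 1) \<le> real W * s"
    proof -
      have "\<theta> * real q ^ (L + 1) = 4 * D * real q ^ (L + 1) * (s / \<tau>)" by (simp add: \<theta>_def)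
      also have "\<dots> \<le> real W * \<tau> * (s / \<tau>)" using W s \<tau> by (intro mult_right_mono) auto
      finally show ?thesis using \<tau> by simp
    qed
    show "1 < (1 - \<epsilon>) * real q ^ ?d"
    proof -
      have "1 / 2 \<le> 1 - \<epsilon>" using L by (simp add: \<epsilon>_def field_simps)
      moreover have "real q \<le> real q ^ ?d" using q by (intro self_le_power) (auto simp: Suc_le_eq)
      then have "4 \<le> real q ^ ?d" using q by linarith
      ultimately have "1 / 2 * 4 \<le> (1 - \<epsilon>) * real q ^ ?d" by (intro mult_mono) auto
      then show ?thesis by simp
    qed
    show "2 * (real (card A) * real (2 * W + 3) ^ ?d)
      \<le> \<epsilon> * real q ^ ?d * ((1 - \<epsilon>) * real q ^ ?d) ^ (L - 1)"
      using few by (simp only: \<epsilon>_def)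
  qed (use A s q L \<theta> in \<open>auto simp: \<epsilon>_def\<close>)
  moreover have "X \<subseteq> {x. (\<lambda>a. x + l *\<^sub>R a) ` A \<subseteq> C}"
  proof safe
    fix x a assume x: "x \<in> X" and a: "a \<in> A"
    have "p \<in> grid_cube p s (\<lambda>b\<in>Basis. 0)" using s by (auto simp: grid_cube_def)
    then have "dist x p \<le> D * s"
      using x s unfolding D_def X_def by (intro dist_grid_cube_le) auto
    moreover have "norm (l *\<^sub>R (a - a0)) < r / 2"
    proof -
      have "dist a a0 \<le> diameter A"
        using A a a0 by (intro diameter_bounded_bound finite_imp_bounded)
      then have "norm (l *\<^sub>R (a - a0)) \<le> l * diameter A"
        using l by (simp add: dist_norm)
      also have "l * diameter A < r / 2"
      proof (cases "diameter A = 0")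
        case False
        then have "0 < diameter A"
          using diameter_ge_0[OF finite_imp_bounded[OF A(1)]] by simp
        moreover then have "l * (16 * diameter A) < 2 * r"
          using l(2) r by (simp add: less_divide_eq)
        ultimately show ?thesis using r l by simp
      qed (use r in simp)
      finally show ?thesis .
    qed
    moreover have "dist (x + l *\<^sub>R a) z \<le> dist x p + norm (l *\<^sub>R (a - a0))"
    proof -
      have "x + l *\<^sub>R a - z = (x - p) + l *\<^sub>R (a - a0)" by (simp add: p_def algebra_simps)
      then show ?thesis by (simp only: dist_norm norm_triangle_ineq)
    qed
    ultimately have "x + l *\<^sub>R a \<in> ball z r" using Ds by (simp add: dist_commute)
    then have out: "x + l *\<^sub>R a \<notin> outer_component C" using B by blast
    show "x + l *\<^sub>R a \<in> C"
    proof (rule ccontr)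
      assume "x + l *\<^sub>R a \<notin> C"
      then obtain U where U: "U \<in> bounded_gaps C" "x + l *\<^sub>R a \<in> U"
        using out complement_point_in_gap by blast
      let ?V = "(\<lambda>u. u - l *\<^sub>R a) ` U"
      have "?V \<in> F a" using U by (simp add: F_def)
      moreover have "0 < diameter ?V"
        using bounded_gap_diameter_pos[OF C U(1)] by (simp add: diameter_translation)
      moreover have "x \<in> ?V" using U(2) by (auto simp: image_iff intro: bexI[of _ "x + l *\<^sub>R a"])
      ultimately show False using x a by (auto simp: X_def)
    qed
  qed
  ultimately show ?thesis using hausdorff_dim_mono by (meson less_le_trans)
qed

theorem theorem7:
  fixes C B :: "'a::euclidean_space set" and z :: 'a and r \<tau> \<beta> :: real
  assumes "compact C"
    and "thickness C = ereal \<tau>"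
    and "0 < \<tau>" and "\<tau> \<noteq> 1"
    and "\<tau> \<notin> {1<..<exp (1 / real DIM('a))}"
    and "0 < r" and "B = ball z r" and "B \<subseteq> - outer_component C"
    and "\<beta> = scale_ratio B C"
  shows "\<forall>A :: 'a set. finite A \<and> int (card A) \<le> max_points DIM('a) \<beta> \<tau> \<longrightarrow>
      (\<exists>S. homothetic_copy A S \<and> S \<subseteq> C) \<and>
      (\<forall>l::real. 0 < l \<and> (diameter A = 0 \<or> l < diameter B / (16 * diameter A)) \<longrightarrow>
         (\<exists>X :: 'a set. 0 < hausdorff_dim X \<and>
            (\<forall>x\<in>X. (\<lambda>a. x + l *\<^sub>R a) ` A \<subseteq> C)))"
proof (intro allI impI)
  fix A :: "'a set"
  assume A: "finite A \<and> int (card A) \<le> max_points DIM('a) \<beta> \<tau>"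
  have dim: "0 < hausdorff_dim {x. (\<lambda>a. x + l *\<^sub>R a) ` A \<subseteq> C}"
    if l: "0 < l" "diameter A = 0 \<or> l < diameter B / (16 * diameter A)" for l
  proof (cases "A = {}")
    case True
    then show ?thesis by (simp add: hausdorff_dim_UNIV_pos)
  next
    case False
    then show ?thesis
      using translates_hausdorff_dim_pos[of C \<tau> r z A l] assms A l by simp
  qed
  show "(\<exists>S. homothetic_copy A S \<and> S \<subseteq> C) \<and>
      (\<forall>l::real. 0 < l \<and> (diameter A = 0 \<or> l < diameter B / (16 * diameter A)) \<longrightarrow>
         (\<exists>X :: 'a set. 0 < hausdorff_dim X \<and>
            (\<forall>x\<in>X. (\<lambda>a. x + l *\<^sub>R a) ` A \<subseteq> C)))"
  proof
    \<comment> \<open>If \<open>A\<close> is a single point or empty, every ratio is admissible.\<close>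
    define l where "l = (if diameter A = 0 then 1 else diameter B / (32 * diameter A))"
    have "0 \<le> diameter A" using A by (simp add: diameter_ge_0 finite_imp_bounded)
    then have l: "0 < l" "diameter A = 0 \<or> l < diameter B / (16 * diameter A)"
      using assms(6,7) by (auto simp: l_def field_simps)
    then have "{x. (\<lambda>a. x + l *\<^sub>R a) ` A \<subseteq> C} \<noteq> {}"
      using dim[OF l] hausdorff_dim_empty by (metis less_irrefl)
    then obtain x where "(\<lambda>a. x + l *\<^sub>R a) ` A \<subseteq> C" by blast
    moreover have "homothetic_copy A ((\<lambda>a. x + l *\<^sub>R a) ` A)"
      unfolding homothetic_copy_def using l by (intro exI[of _ x] exI[of _ l]) simp
    ultimately show "\<exists>S. homothetic_copy A S \<and> S \<subseteq> C" by blast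
  qed (use dim in blast)
qed

end
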